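(* Let $\mathcal{X}$ be a finite set, $p_X\in\mathscr{P}(\mathcal{X})$, and $\mathbf{g}:\mathscr{P}(\mathcal{X})\to\mathbb{R}^d$ twice continuously differentiable. Let $g_t'(x):=\partial g_t(q_X)/\partial q_X(x)|_{q_X=p_X}$ for $t=1,\dots,d$, $\mathbf{g}'(x):=(g_1'(x),\dots,g_d'(x))^T$, and for $X\sim p_X$ let $\mathbf{V}:=\mathrm{Cov}(\mathbf{g}'(X))$. Assume $\mathrm{rank}(\mathbf{V})\ge1$ and $\xi:=\mathsf{E}[\|\mathbf{g}'(X)-\mathsf{E}\mathbf{g}'(X)\|_2^3]<\infty$. Let $\kappa:=\max_{1\le t\le d}\|\nabla^2_{p_X}g_t(p_X)\|_2$ (spectral norm of the Hessian) and $b_n:=(\kappa+1)\log n/n$. Let $X^n=(X_1,\dots,X_n)$ be i.i.d. with law $p_X$ and $P_{X^n}$ its type. Then for any fixed $\mathbf{z}\in\mathbb{R}^d$, $$\mathsf{P}\Big(\mathbf{g}(P_{X^n})\ge\mathbf{g}(p_X)+\frac{\mathbf{z}}{\sqrt n}-b_n\mathbf{1}\Big)\ge\mathsf{P}(\mathbf{Z}\ge\mathbf{z})+O\Big(\frac{\log n}{\sqrt n}\Big),$$ where $\mathbf{Z}\sim\mathcal{N}(\mathbf{0},\mathbf{V})$.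
   Context: $\mathscr{P}(\mathcal{X})$ is the probability simplex on the finite set $\mathcal{X}$, viewed as a subset of $\mathbb{R}^{|\mathcal{X}|}$. The type of $x^n$ is the empirical distribution $P_{x^n}(a):=\frac1n|\{k:x_k=a\}|$. Vector inequalities are componentwise, $\mathbf{1}$ is the all-ones vector, logarithms are base 2. $O(\log n/\sqrt n)$ denotes a term bounded in absolute value by $C\log n/\sqrt n$ for some constant $C$ independent of $n$. *)

theory Defs
  imports "HOL-Probability.Probability"
begin

definition prob_simplex :: "(real^'a::finite) set" where
  "prob_simplex = {q. (\<forall>x. 0 \<le> q $ x) \<and> (\<Sum>x\<in>UNIV. q $ x) = 1}"

definition type_of :: "'a::finite list \<Rightarrow> real^'a" where
  "type_of xs = (\<chi> a. real (count_list xs a) / real (length xs))"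

definition iid_prob :: "real^'a::finite \<Rightarrow> nat \<Rightarrow> ('a list \<Rightarrow> bool) \<Rightarrow> real" where
  "iid_prob p n E = (\<Sum>xs\<in>{xs. length xs = n \<and> E xs}. \<Prod>i<n. p $ (xs ! i))"

definition outer :: "real^'d \<Rightarrow> real^'d^'d" where
  "outer v = (\<chi> i j. v $ i * v $ j)"

definition std_gauss :: "('d::finite \<Rightarrow> real) measure" where
  "std_gauss = PiM UNIV (\<lambda>_. std_normal_distribution)"

text \<open>P(Z \<ge> z) for Z ~ N(0,V), realised as Z = A W with A A^T = V
  (the standard definition of a possibly degenerate multivariate normal law).\<close>
definition gauss_upper_prob :: "real^'d::finite^'d \<Rightarrow> real^'d \<Rightarrow> real" where
  "gauss_upper_prob V z =
     measure (std_gauss :: ('d \<Rightarrow> real) measure) {w \<in> space (std_gauss :: ('d \<Rightarrow> real) measure).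
        z \<le> (SOME A. A ** transpose A = V) *v (\<chi> i. w i)}"

end

theory Submission
  imports Defs
begin

text \<open>
  By a second-order Taylor expansion, \<open>g\<close> at the type differs from its linearisation by at most
  \<open>(\<kappa> + 1) / 2\<close> times the squared distance of the type to \<open>p\<close>. A finite net of directions and
  exponential moments show that this is at most \<open>b\<^sub>n\<close> outside an event of probability
  \<open>O(n\<^sup>-\<^sup>1\<^sup>/\<^sup>2)\<close>, so it remains to prove a Berry-Esseen bound on orthants for the linear part.

  Write the centred steps as \<open>A \<xi>\<close> with \<open>\<xi>\<close> of identity covariance, and exchange them for
  Gaussian ones one at a time (Lindeberg). When \<open>m\<close> steps are already Gaussian, exchanging one more
  changes the likelihood ratio with respect to \<open>\<surd>m W\<close> by only \<open>O(m\<^sup>-\<^sup>3\<^sup>/\<^sup>2)\<close>, without any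
  differentiation of the indicator. This matters only if the walk of the remaining \<open>k\<close> steps is
  within \<open>O(\<surd>m)\<close> of one of the hyperplanes bounding the orthant, which by a one-dimensional Fourier
  estimate has probability \<open>O(\<surd>m / \<surd>k)\<close>. The sum of \<open>1 / (m \<surd>k)\<close> over \<open>m + k = n\<close>
  is \<open>O(log n / \<surd>n)\<close>.
\<close>

section \<open>Random walks on a finite step space and their concentration\<close>

text \<open>The laws to be compared have no common density: types are lattice-valued and
  \<open>V\<close> may be singular. A single exchange is therefore compared before \<open>A\<close>
  is applied, where both laws have densities as soon as m > 0 Gaussian steps are present. The walk
  step shares mean zero and identity covariance with the Gaussian step, so the two likelihood ratios
  agree through second order in 1 / sqrt m. Both have total mass 1, so a constant may be subtracted
  from the indicator before estimating; this brings in the distance to the hyperplanes. Without that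
  factor the errors m^(-3/2) would only sum to O(1). For m = 0 there is no density, and that one
  exchange is estimated crudely. The hyperplane estimate uses only frequencies below a fixed bound,
  where the characteristic function decays like a Gaussian, so lattice steps do no harm. In b_n the
  summand 1 next to \<kappa> absorbs the variation of the Hessian near p. That the logarithm has
  base 2 leaves room in the tail bound for the loss caused by a finite net of directions.\<close>

text \<open>\<open>walk q \<xi> n h\<close> is \<open>E h(S\<^sub>n)\<close> for the walk \<open>S\<close> started at \<open>0\<close> with i.i.d. steps \<open>\<xi> x\<close>
  of weight \<open>q x\<close>.\<close>

definition walk :: "('b::finite \<Rightarrow> real) \<Rightarrow> ('b \<Rightarrow> 'v::real_vector) \<Rightarrow> nat \<Rightarrow> ('v \<Rightarrow> real) \<Rightarrow> real" where
  "walk q \<xi> n h = (\<Sum>xs | length xs = n. prod_list (map q xs) * h (sum_list (map \<xi> xs)))"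

lemma finite_length_eq: "finite {xs :: 'b::finite list. length xs = n}"
  using finite_lists_length_eq[of "UNIV :: 'b set" n] by simp

lemma sum_length_Suc:
  fixes F :: "'b::finite list \<Rightarrow> real"
  shows "(\<Sum>xs | length xs = Suc n. F xs) = (\<Sum>xs | length xs = n. \<Sum>x\<in>UNIV. F (x # xs))"
proof -
  have eq: "{xs :: 'b list. length xs = Suc n} = (\<lambda>(xs, x). x # xs) ` ({xs. length xs = n} \<times> UNIV)"
    by (force simp: length_Suc_conv image_iff)
  have "(\<Sum>xs | length xs = Suc n. F xs) = (\<Sum>(xs, x)\<in>{xs. length xs = n} \<times> UNIV. F (x # xs))"
    unfolding eq by (subst sum.reindex) (auto simp: inj_on_def case_prod_unfold)
  thus ?thesis
    by (simp add: sum.cartesian_product)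
qed

lemma walk_0 [simp]: "walk q \<xi> 0 h = h 0"
  by (simp add: walk_def)

text \<open>The head of the list supplies the step averaged into the test function, so
  \<open>walk\<close> iterates an averaging operator; inductions on \<open>n\<close> can let the
  test function vary.\<close>

lemma walk_Suc: "walk q \<xi> (Suc n) h = walk q \<xi> n (\<lambda>u. \<Sum>x\<in>UNIV. q x * h (u + \<xi> x))"
  unfolding walk_def sum_length_Suc sum_distrib_left
  by (intro sum.cong refl) (simp add: algebra_simps)

lemma walk_cmult: "walk q \<xi> n (\<lambda>u. c * h u) = c * walk q \<xi> n h"
  unfolding walk_def sum_distrib_left by (intro sum.cong refl) (simp add: algebra_simps)

lemma walk_diff: "walk q \<xi> n (\<lambda>u. h u - k u) = walk q \<xi> n h - walk q \<xi> n k"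
  unfolding walk_def by (simp add: algebra_simps sum_subtractf)

lemma walk_add: "walk q \<xi> n (\<lambda>u. h u + k u) = walk q \<xi> n h + walk q \<xi> n k"
  unfolding walk_def by (simp add: algebra_simps sum.distrib)

lemma walk_sum: "walk q \<xi> n (\<lambda>u. \<Sum>i\<in>I. h i u) = (\<Sum>i\<in>I. walk q \<xi> n (h i))"
  unfolding walk_def sum_distrib_left by (rule sum.swap)

lemma walk_mono:
  assumes "\<And>x. q x \<ge> 0" "\<And>u. h u \<le> k u"
  shows "walk q \<xi> n h \<le> walk q \<xi> n k"
  unfolding walk_def
  by (intro sum_mono mult_left_mono assms prod_list_nonneg) (use assms in auto)

lemma walk_abs_le:
  assumes "\<And>x. q x \<ge> 0" "\<And>u. \<bar>h u\<bar> \<le> k u"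
  shows "\<bar>walk q \<xi> n h\<bar> \<le> walk q \<xi> n k"
proof -
  have "walk q \<xi> n h \<le> walk q \<xi> n k" "walk q \<xi> n (\<lambda>u. (-1) * h u) \<le> walk q \<xi> n k"
    using assms by (intro walk_mono; fastforce simp: abs_le_iff)+
  moreover have "walk q \<xi> n (\<lambda>u. (-1) * h u) = - walk q \<xi> n h"
    by (subst walk_cmult) simp
  ultimately show ?thesis by linarith
qed

text \<open>The walk is a finite sum, so it commutes with the integral without any joint
  measurability.\<close>

lemma walk_integral:
  assumes "\<And>u. integrable M (\<lambda>w. h w u)"
  shows "integrable M (\<lambda>w. walk q \<xi> n (h w))"
    and "walk q \<xi> n (\<lambda>u. \<integral>w. h w u \<partial>M) = (\<integral>w. walk q \<xi> n (h w) \<partial>M)"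
  unfolding walk_def using assms by (auto simp: Bochner_Integration.integral_sum)

text \<open>Serves to project a walk onto a normal of a hyperplane, to apply \<open>A\<close> to the
  lifted walk, and to linearise \<open>g\<close>.\<close>

lemma walk_linear_image:
  assumes "linear L"
  shows "walk q \<xi> n (\<lambda>u. h (L u)) = walk q (\<lambda>x. L (\<xi> x)) n h"
proof -
  have "L (sum_list (map \<xi> xs)) = sum_list (map (\<lambda>x. L (\<xi> x)) xs)" for xs
    by (induction xs) (simp_all add: linear_add[OF assms] linear_0[OF assms])
  thus ?thesis by (simp add: walk_def)
qed

section \<open>Interval probabilities of one-dimensional walks by Fourier analysis\<close>

lemma one_minus_cos_ge:
  fixes x :: real
  assumes "\<bar>x\<bar> \<le> 1"
  shows "x\<^sup>2 / 4 \<le> 1 - cos x"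
proof -
  obtain t where "cos x = (\<Sum>m<4. cos_coeff m * x ^ m) + (cos (t + 1/2 * real 4 * pi) / fact 4) * x ^ 4"
    using Maclaurin_cos_expansion[of x 4] by auto
  moreover have "(\<Sum>m<4. cos_coeff m * x ^ m) = 1 - x\<^sup>2 / 2"
    by (simp add: eval_nat_numeral) (simp add: cos_coeff_def)
  moreover have "(cos (t + 1/2 * real 4 * pi) / fact 4) * x ^ 4 \<le> (1 / 24) * x ^ 4"
    by (intro mult_right_mono) (simp_all add: fact_numeral)
  moreover have "x ^ 4 \<le> x\<^sup>2"
  proof -
    have "x\<^sup>2 * x\<^sup>2 \<le> x\<^sup>2 * 1"
      using assms by (intro mult_left_mono) (auto simp: abs_square_le_1)
    thus ?thesis by (simp add: eval_nat_numeral)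
  qed
  ultimately show ?thesis using zero_le_power2[of x] by linarith
qed

lemma cos_ge_half:
  fixes x :: real
  assumes "\<bar>x\<bar> \<le> 1"
  shows "1 / 2 \<le> cos x"
proof -
  obtain t where "cos x = (\<Sum>m<2. cos_coeff m * x ^ m) + (cos (t + 1/2 * real 2 * pi) / fact 2) * x ^ 2"
    using Maclaurin_cos_expansion[of x 2] by auto
  moreover have "(\<Sum>m<2. cos_coeff m * x ^ m) = 1"
    by (simp add: cos_coeff_def eval_nat_numeral)
  moreover have "-1 * x\<^sup>2 \<le> cos (t + 1/2 * real 2 * pi) * x\<^sup>2"
    by (intro mult_right_mono) (simp_all del: mult_minus1)
  moreover have "x\<^sup>2 \<le> 1"
    using assms by (simp add: abs_square_le_1)
  ultimately show ?thesis by simp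
qed

text \<open>The Fejer kernel (1 - cos x) / x^2, written as an average of cosines: it is nonnegative
  and bounded below near 0, yet contains only frequencies in [0, 1].\<close>

definition fejer :: "real \<Rightarrow> real" where
  "fejer x = integral {0..1} (\<lambda>t. (1 - t) * cos (t * x))"

lemma fejer_integrable: "(\<lambda>t. (1 - t) * cos (t * x :: real)) integrable_on {0..1}"
  by (intro integrable_continuous_real continuous_intros)

lemma fejer_nonneg: "0 \<le> fejer x"
proof (cases "x = 0")
  case True
  have "0 \<le> integral {0..1} (\<lambda>t::real. (1 - t) * cos (t * x))"
    by (rule integral_nonneg[OF fejer_integrable]) (simp add: True)
  thus ?thesis by (simp add: fejer_def)
next
  case False
  have "((\<lambda>t. (1 - t) * cos (t * x)) has_integral
      ((1 - 1) * sin (1 * x) / x - cos (1 * x) / x\<^sup>2) - ((1 - 0) * sin (0 * x) / x - cos (0 * x) / x\<^sup>2)) {0..1}"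
    using False
    by (intro fundamental_theorem_of_calculus)
       (auto intro!: derivative_eq_intros simp: has_real_derivative_iff_has_vector_derivative[symmetric]
          field_simps power2_eq_square)
  hence "fejer x = (1 - cos x) / x\<^sup>2"
    by (simp add: fejer_def integral_unique diff_divide_distrib)
  thus ?thesis by simp
qed

lemma fejer_ge:
  assumes "\<bar>x\<bar> \<le> 1"
  shows "1 / 4 \<le> fejer x"
proof -
  have "((\<lambda>t::real. (1 - t) * (1 / 2)) has_integral ((1 - 1 / 2 * 1\<^sup>2) / 2 - (0 - 1 / 2 * 0\<^sup>2) / 2)) {0..1}"
    by (intro fundamental_theorem_of_calculus)
       (auto intro!: derivative_eq_intros simp: has_real_derivative_iff_has_vector_derivative[symmetric]
          field_simps power2_eq_square)
  hence i: "((\<lambda>t::real. (1 - t) * (1 / 2)) has_integral 1 / 4) {0..1}"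
    by simp
  have "integral {0..1} (\<lambda>t::real. (1 - t) * (1 / 2)) \<le> fejer x"
    unfolding fejer_def
  proof (rule integral_le)
    show "(1 - t) * (1 / 2) \<le> (1 - t) * cos (t * x)" if "t \<in> {0..1}" for t
    proof (intro mult_left_mono cos_ge_half)
      show "\<bar>t * x\<bar> \<le> 1"
        using that assms by (auto simp: abs_mult intro: mult_le_one)
    qed (use that in auto)
  qed (use i fejer_integrable in \<open>auto simp: has_integral_integrable_integral\<close>)
  thus ?thesis unfolding integral_unique[OF i] .
qed

text \<open>A real form of the fact that characters are eigenfunctions of the transition operator:
  the polar form \<open>R cos \<alpha>\<close>, \<open>R sin \<alpha>\<close> is that of the characteristic function at \<open>\<tau>\<close>.\<close>

lemma walk_cos_le:
  fixes \<eta> :: "'b::finite \<Rightarrow> real"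
  assumes q: "\<And>x. q x \<ge> 0" "(\<Sum>x\<in>UNIV. q x) = 1"
    and mean: "(\<Sum>x\<in>UNIV. q x * \<eta> x) = 0" and var: "(\<Sum>x\<in>UNIV. q x * (\<eta> x)\<^sup>2) = v"
    and \<tau>: "\<And>x y. \<bar>\<tau> * (\<eta> x - \<eta> y)\<bar> \<le> 1"
  shows "\<bar>walk q \<eta> n (\<lambda>u. cos (\<tau> * u - \<beta>))\<bar> \<le> exp (- \<tau>\<^sup>2 * v / 4) ^ n"
proof -
  define c where "c = (\<Sum>x\<in>UNIV. q x * cos (\<tau> * \<eta> x))"
  define s where "s = (\<Sum>x\<in>UNIV. q x * sin (\<tau> * \<eta> x))"
  obtain R \<alpha> where R: "c = R * cos \<alpha>" "s = R * sin \<alpha>"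
    using polar_Ex by blast
  \<comment> \<open>The squared modulus of the characteristic function is the characteristic
    function of the difference of two independent steps. It is real, so the cosine bound alone
    suffices.\<close>
  have "R\<^sup>2 = c\<^sup>2 + s\<^sup>2"
    by (simp add: R power_mult_distrib flip: distrib_left)
  also have "\<dots> = (\<Sum>x\<in>UNIV. \<Sum>y\<in>UNIV. q x * q y * cos (\<tau> * (\<eta> x - \<eta> y)))"
    by (simp add: c_def s_def power2_eq_square sum_product cos_diff right_diff_distrib
        flip: sum.distrib) (simp add: algebra_simps)
  also have "\<dots> \<le> (\<Sum>x\<in>UNIV. \<Sum>y\<in>UNIV. q x * q y * (1 - (\<tau> * (\<eta> x - \<eta> y))\<^sup>2 / 4))"
    using one_minus_cos_ge[OF \<tau>] q
    by (intro sum_mono mult_left_mono) (auto simp: algebra_simps)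
  also have "\<dots> = (\<Sum>x\<in>UNIV. q x * (\<Sum>y\<in>UNIV. q y)) - \<tau>\<^sup>2 / 4 *
     ((\<Sum>x\<in>UNIV. q x * (\<eta> x)\<^sup>2) * (\<Sum>y\<in>UNIV. q y) + (\<Sum>x\<in>UNIV. q x) * (\<Sum>y\<in>UNIV. q y * (\<eta> y)\<^sup>2)
      - 2 * ((\<Sum>x\<in>UNIV. q x * \<eta> x) * (\<Sum>y\<in>UNIV. q y * \<eta> y)))"
    unfolding sum_product
    by (simp add: sum_distrib_left flip: sum.distrib sum_subtractf)
       (simp add: field_simps power2_eq_square)
  also have "\<dots> = 1 - \<tau>\<^sup>2 * v / 2"
    using q by (simp add: mean var)
  also have "\<dots> \<le> exp (- \<tau>\<^sup>2 * v / 2)"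
    using exp_ge_add_one_self[of "- \<tau>\<^sup>2 * v / 2"] by simp
  also have "\<dots> = (exp (- \<tau>\<^sup>2 * v / 4))\<^sup>2"
    by (simp add: power2_eq_square flip: exp_add)
  finally have Rle: "\<bar>R\<bar> \<le> exp (- \<tau>\<^sup>2 * v / 4)"
    by (metis abs_exp_cancel abs_le_square_iff)
  have "\<bar>walk q \<eta> n (\<lambda>u. cos (\<tau> * u - \<beta>))\<bar> \<le> \<bar>R\<bar> ^ n"
  proof (induction n arbitrary: \<beta>)
    case (Suc n)
    have "(\<Sum>x\<in>UNIV. q x * cos (\<tau> * (u + \<eta> x) - \<beta>)) = R * cos (\<tau> * u - (\<beta> - \<alpha>))" for u
    proof -
      have "(\<Sum>x\<in>UNIV. q x * cos (\<tau> * (u + \<eta> x) - \<beta>)) =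
            (\<Sum>x\<in>UNIV. q x * cos ((\<tau> * u - \<beta>) + \<tau> * \<eta> x))"
        by (simp add: algebra_simps)
      also have "\<dots> = cos (\<tau> * u - \<beta>) * c - sin (\<tau> * u - \<beta>) * s"
        unfolding cos_add c_def s_def sum_distrib_left sum_subtractf[symmetric]
        by (intro sum.cong refl) (simp add: algebra_simps)
      also have "\<dots> = R * cos ((\<tau> * u - \<beta>) + \<alpha>)"
        by (subst cos_add) (simp add: R algebra_simps)
      finally show ?thesis by (simp add: algebra_simps)
    qed
    thus ?case
      using Suc.IH[of "\<beta> - \<alpha>"] by (simp add: walk_Suc walk_cmult abs_mult mult_left_mono)
  qed auto
  also have "\<dots> \<le> exp (- \<tau>\<^sup>2 * v / 4) ^ n"
    by (intro power_mono Rle) auto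
  finally show ?thesis .
qed

text \<open>1 / (1 + y^2) replaces exp (- y^2) as a majorant: it has an elementary antiderivative
  and still gives the order 1 / c.\<close>

lemma integral_inverse_quadratic_le:
  fixes c :: real
  assumes "c > 0"
  shows "(\<lambda>t. 1 / (1 + (c * t)\<^sup>2)) integrable_on {0..1}"
    and "integral {0..1} (\<lambda>t. 1 / (1 + (c * t)\<^sup>2)) \<le> 2 / c"
proof -
  have "((\<lambda>t. 1 / (1 + (c * t)\<^sup>2)) has_integral (arctan (c * 1) / c - arctan (c * 0) / c)) {0..1}"
    using assms
    by (intro fundamental_theorem_of_calculus)
       (auto intro!: derivative_eq_intros simp: has_real_derivative_iff_has_vector_derivative[symmetric]
          inverse_eq_divide)
  moreover have "arctan c \<le> 2"
    using arctan_ubound[of c] pi_less_4 by linarith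
  ultimately show "(\<lambda>t. 1 / (1 + (c * t)\<^sup>2)) integrable_on {0..1}"
    "integral {0..1} (\<lambda>t. 1 / (1 + (c * t)\<^sup>2)) \<le> 2 / c"
    using assms by (auto simp: has_integral_integrable_integral divide_right_mono)
qed

lemma walk_small_interval:
  fixes \<eta> :: "'b::finite \<Rightarrow> real"
  assumes q: "\<And>x. q x \<ge> 0" "(\<Sum>x\<in>UNIV. q x) = 1"
    and mean: "(\<Sum>x\<in>UNIV. q x * \<eta> x) = 0" and var: "(\<Sum>x\<in>UNIV. q x * (\<eta> x)\<^sup>2) = v" "v > 0"
    and \<tau>: "\<tau> > 0" "\<And>x y. \<bar>\<tau> * (\<eta> x - \<eta> y)\<bar> \<le> 1"
    and n: "n > 0"
  shows "walk q \<eta> n (\<lambda>u. of_bool (\<bar>u - z\<bar> \<le> 1 / \<tau>)) \<le> 16 / (\<tau> * sqrt v * sqrt n)"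
proof -
  \<comment> \<open>Chosen so that the n-th power of the bound in \<open>walk_cos_le\<close> at
    frequency t \<tau> becomes exp (- (c t)^2). The final constant is 4 * 2 / c.\<close>
  define c where "c = \<tau> * sqrt v * sqrt n / 2"
  have c: "c > 0" using var \<tau> n by (simp add: c_def)
  have "walk q \<eta> n (\<lambda>u. of_bool (\<bar>u - z\<bar> \<le> 1 / \<tau>)) \<le> walk q \<eta> n (\<lambda>u. 4 * fejer (\<tau> * (u - z)))"
  proof (intro walk_mono q)
    fix u
    show "of_bool (\<bar>u - z\<bar> \<le> 1 / \<tau>) \<le> 4 * fejer (\<tau> * (u - z))"
      using fejer_nonneg[of "\<tau> * (u - z)"] fejer_ge[of "\<tau> * (u - z)"] \<tau>(1)
      by (auto simp: abs_mult pos_le_divide_eq mult.commute[of _ \<tau>])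
  qed
  also have "\<dots> = 4 * walk q \<eta> n (\<lambda>u. fejer (\<tau> * (u - z)))"
    by (rule walk_cmult)
  also have "walk q \<eta> n (\<lambda>u. fejer (\<tau> * (u - z))) =
      integral {0..1} (\<lambda>t. walk q \<eta> n (\<lambda>u. (1 - t) * cos (t * (\<tau> * (u - z)))))"
    unfolding walk_def fejer_def
    by (subst integral_sum)
       (auto intro!: finite_length_eq integrable_on_mult_right fejer_integrable)
  also have "\<dots> = integral {0..1} (\<lambda>t. (1 - t) * walk q \<eta> n (\<lambda>u. cos ((t * \<tau>) * u - t * \<tau> * z)))"
    by (simp only: walk_cmult) (simp add: algebra_simps)
  also have "\<dots> \<le> integral {0..1} (\<lambda>t. 1 / (1 + (c * t)\<^sup>2))"
  proof (rule integral_le)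
    show "(\<lambda>t. (1 - t) * walk q \<eta> n (\<lambda>u. cos ((t * \<tau>) * u - t * \<tau> * z))) integrable_on {0..1}"
      unfolding walk_def by (intro integrable_continuous_real continuous_intros)
    show "(\<lambda>t. 1 / (1 + (c * t)\<^sup>2)) integrable_on {0..1}"
      using integral_inverse_quadratic_le[OF c] by simp
    fix t :: real assume t: "t \<in> {0..1}"
    have "\<bar>t * \<tau> * (\<eta> x - \<eta> y)\<bar> \<le> 1" for x y
      using \<tau>(2)[of x y] t by (auto simp: abs_mult mult.assoc intro!: mult_le_one)
    hence "\<bar>walk q \<eta> n (\<lambda>u. cos ((t * \<tau>) * u - t * \<tau> * z))\<bar> \<le> exp (- (t * \<tau>)\<^sup>2 * v / 4) ^ n"
      by (intro walk_cos_le q mean var(1))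
    also have "\<dots> = exp (- (c * t)\<^sup>2)"
      using var(2) by (simp add: c_def power_mult_distrib power_divide mult_ac flip: exp_of_nat_mult)
    also have "\<dots> \<le> 1 / (1 + (c * t)\<^sup>2)"
      using exp_ge_add_one_self[of "(c * t)\<^sup>2"]
      by (simp add: exp_minus field_simps add_pos_nonneg)
    finally have *: "\<bar>walk q \<eta> n (\<lambda>u. cos ((t * \<tau>) * u - t * \<tau> * z))\<bar> \<le> 1 / (1 + (c * t)\<^sup>2)" .
    have "(1 - t) * walk q \<eta> n (\<lambda>u. cos ((t * \<tau>) * u - t * \<tau> * z)) \<le> 1 * (1 / (1 + (c * t)\<^sup>2))"
      by (rule order_trans[OF mult_left_mono[OF order_trans[OF abs_ge_self *]] mult_right_mono])
         (use t in auto)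
    thus "(1 - t) * walk q \<eta> n (\<lambda>u. cos ((t * \<tau>) * u - t * \<tau> * z)) \<le> 1 / (1 + (c * t)\<^sup>2)"
      by simp
  qed
  also have "\<dots> \<le> 2 / c"
    by (rule integral_inverse_quadratic_le(2)[OF c])
  finally show ?thesis
    by (simp add: c_def)
qed

text \<open>A long interval is covered by O(L + 1) short ones of fixed length. Dividing by sqrt (n +
  1) instead of sqrt n includes n = 0, where the probability is at most 1.\<close>

lemma walk_interval:
  fixes \<eta> :: "'b::finite \<Rightarrow> real"
  assumes q: "\<And>x. q x \<ge> 0" "(\<Sum>x\<in>UNIV. q x) = 1"
    and mean: "(\<Sum>x\<in>UNIV. q x * \<eta> x) = 0" and var: "(\<Sum>x\<in>UNIV. q x * (\<eta> x)\<^sup>2) > 0"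
  shows "\<exists>C\<ge>0. \<forall>n z L. L \<ge> 0 \<longrightarrow>
    walk q \<eta> n (\<lambda>u. of_bool (\<bar>u - z\<bar> \<le> L)) \<le> C * (L + 1) / sqrt (real n + 1)"
proof -
  define v where "v = (\<Sum>x\<in>UNIV. q x * (\<eta> x)\<^sup>2)"
  \<comment> \<open>The sum bounds all differences of steps; the extra 1 makes \<tau> \<le> 1, so
    that the number of covering intervals is bounded in terms of \<open>L\<close> alone.\<close>
  define M where "M = 1 + 2 * (\<Sum>x\<in>UNIV. \<bar>\<eta> x\<bar>)"
  define \<tau> where "\<tau> = 1 / M"
  have "M \<ge> 1" by (simp add: M_def sum_nonneg)
  hence \<tau>: "\<tau> > 0" "\<tau> \<le> 1" by (auto simp: \<tau>_def)
  have abs_le: "\<bar>\<eta> x\<bar> \<le> (\<Sum>x\<in>UNIV. \<bar>\<eta> x\<bar>)" for x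
    by (rule member_le_sum) auto
  have \<tau>\<eta>: "\<bar>\<tau> * (\<eta> x - \<eta> y)\<bar> \<le> 1" for x y
    using abs_le[of x] abs_le[of y] \<open>M \<ge> 1\<close>
    by (simp add: \<tau>_def abs_mult field_simps) (simp add: M_def)
  \<comment> \<open>32 is 16 times the factor 2 lost in sqrt (n + 1) \<le> 2 sqrt n; the summand 1
    is for n = 0.\<close>
  define K where "K = 1 + 32 / (\<tau> * sqrt v)"
  have v: "v > 0" using var by (simp add: v_def)
  have K: "K \<ge> 1" using v \<tau> by (simp add: K_def)
  have small: "walk q \<eta> n (\<lambda>u. of_bool (\<bar>u - z\<bar> \<le> 1 / \<tau>)) \<le> K / sqrt (real n + 1)" for n z
  proof (cases "n = 0")
    case True
    thus ?thesis using K by auto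
  next
    case False
    have "sqrt (real n + 1) \<le> sqrt (4 * real n)"
      using False by (intro real_sqrt_le_mono) linarith
    hence s: "sqrt (real n + 1) \<le> 2 * sqrt (real n)"
      by (simp add: real_sqrt_mult)
    have "walk q \<eta> n (\<lambda>u. of_bool (\<bar>u - z\<bar> \<le> 1 / \<tau>)) \<le> 16 / (\<tau> * sqrt v * sqrt n)"
      using False v \<tau> by (intro walk_small_interval q mean \<tau>\<eta>) (auto simp: v_def)
    also have "\<dots> \<le> (32 / (\<tau> * sqrt v)) / sqrt (real n + 1)"
      using s False v \<tau> by (simp add: field_simps)
    also have "\<dots> \<le> K / sqrt (real n + 1)"
      by (intro divide_right_mono) (simp_all add: K_def)
    finally show ?thesis .
  qed
  have "walk q \<eta> n (\<lambda>u. of_bool (\<bar>u - z\<bar> \<le> L)) \<le> 2 * K * (L + 1) / sqrt (real n + 1)"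
    if L: "L \<ge> 0" for n z L
  proof -
    define N where "N = Suc (nat \<lfloor>L * \<tau>\<rfloor>)"
    \<comment> \<open>Centres of consecutive intervals of length 2 / \<tau>, the first one starting
      at z - L. Below, \<open>y\<close> is the position of \<open>u\<close> in units of that
      length.\<close>
    define zz where "zz j = z - L + (2 * real j + 1) / \<tau>" for j
    have "walk q \<eta> n (\<lambda>u. of_bool (\<bar>u - z\<bar> \<le> L)) \<le>
          walk q \<eta> n (\<lambda>u. \<Sum>j<N. of_bool (\<bar>u - zz j\<bar> \<le> 1 / \<tau>))"
    proof (intro walk_mono q)
      fix u
      show "of_bool (\<bar>u - z\<bar> \<le> L) \<le> (\<Sum>j<N. of_bool (\<bar>u - zz j\<bar> \<le> 1 / \<tau>) :: real)"
      proof (cases "\<bar>u - z\<bar> \<le> L")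
        case True
        define y where "y = (u - z + L) * \<tau> / 2"
        have y0: "y \<ge> 0" using True \<tau> by (auto simp: y_def intro!: divide_nonneg_pos mult_nonneg_nonneg)
        have y1: "y \<le> L * \<tau>" using True mult_right_mono[of "u - z + L" "2 * L" \<tau>] \<tau> by (simp add: y_def)
        define j where "j = nat \<lfloor>y\<rfloor>"
        have jN: "j < N"
          using floor_mono[OF y1] by (simp add: N_def j_def nat_mono le_imp_less_Suc)
        have j: "real j \<le> y" "y < real j + 1"
          using y0 unfolding j_def by linarith+
        have "\<bar>u - zz j\<bar> = \<bar>2 * y - 2 * real j - 1\<bar> / \<tau>"
          using \<tau> by (simp add: zz_def y_def field_simps abs_if split: if_splits)
        also have "\<dots> \<le> 1 / \<tau>"
          using j \<tau> by (intro divide_right_mono) (auto simp: abs_le_iff)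
        finally have "\<bar>u - zz j\<bar> \<le> 1 / \<tau>" .
        hence "of_bool (\<bar>u - z\<bar> \<le> L) \<le> (of_bool (\<bar>u - zz j\<bar> \<le> 1 / \<tau>) :: real)"
          by simp
        also have "\<dots> \<le> (\<Sum>j<N. of_bool (\<bar>u - zz j\<bar> \<le> 1 / \<tau>))"
          by (rule member_le_sum[of j "{..<N}" "\<lambda>j. of_bool (\<bar>u - zz j\<bar> \<le> 1 / \<tau>)"]) (use jN in auto)
        finally show ?thesis .
      qed (auto intro: sum_nonneg)
    qed
    also have "\<dots> = (\<Sum>j<N. walk q \<eta> n (\<lambda>u. of_bool (\<bar>u - zz j\<bar> \<le> 1 / \<tau>)))"
      by (rule walk_sum)
    also have "\<dots> \<le> real N * (K / sqrt (real n + 1))"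
      using sum_bounded_above[of "{..<N}" "\<lambda>j. walk q \<eta> n (\<lambda>u. of_bool (\<bar>u - zz j\<bar> \<le> 1 / \<tau>))"
        "K / sqrt (real n + 1)"] small
      by simp
    also have "\<dots> \<le> (2 * (L + 1)) * (K / sqrt (real n + 1))"
    proof (rule mult_right_mono)
      have "L * \<tau> \<le> L" using \<tau> L by (simp add: mult_left_le)
      moreover have "L * \<tau> \<ge> 0" using \<tau> L by simp
      ultimately have "real (nat \<lfloor>L * \<tau>\<rfloor>) \<le> L"
        using of_nat_floor[of "L * \<tau>"] by linarith
      thus "real N \<le> 2 * (L + 1)"
        using L by (simp add: N_def)
    qed (use K in auto)
    finally show ?thesis by (simp add: mult_ac)
  qed
  thus ?thesis using K by (intro exI[of _ "2 * K"]) auto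
qed

section \<open>The standard Gaussian measure\<close>

definition gauss_density :: "real^'d::finite \<Rightarrow> real" where
  "gauss_density w = (\<Prod>i\<in>UNIV. std_normal_density (w $ i))"

text \<open>A copy of \<open>std_gauss\<close> on \<open>real^'d\<close>, where inner product and
  norm are available and shifts and dilations are changes of variables in Lebesgue measure.\<close>

definition gauss_measure :: "(real^'d::finite) measure" where
  "gauss_measure = density lborel (\<lambda>w. ennreal (gauss_density w))"

lemma power2_norm_vec: "(norm (w :: real^'d::finite))\<^sup>2 = (\<Sum>i\<in>UNIV. (w $ i)\<^sup>2)"
  unfolding power2_norm_eq_inner inner_vec_def by (simp add: power2_eq_square)

lemma gauss_density_eq:
  "gauss_density (w :: real^'d::finite) = (1 / sqrt (2 * pi)) ^ CARD('d) * exp (- (norm w)\<^sup>2 / 2)"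
  by (simp add: gauss_density_def std_normal_density_def prod.distrib power2_norm_vec
      sum_divide_distrib power_one_over prod_dividef flip: exp_sum sum_negf)

lemma gauss_density_nonneg [simp]: "0 \<le> gauss_density w"
  by (simp add: gauss_density_def prod_nonneg)

lemma borel_measurable_gauss_density [measurable]: "gauss_density \<in> borel_measurable borel"
proof -
  have "continuous_on UNIV (gauss_density :: real^'d \<Rightarrow> real)"
    unfolding gauss_density_eq[abs_def] by (intro continuous_intros) auto
  thus ?thesis by (rule borel_measurable_continuous_onI)
qed

lemma sets_gauss_measure [measurable_cong, simp]: "sets gauss_measure = sets borel"
  and space_gauss_measure [simp]: "space gauss_measure = UNIV"
  by (simp_all add: gauss_measure_def)

lemma nn_integral_lborel_vec_prod:
  fixes f :: "'d::finite \<Rightarrow> real \<Rightarrow> ennreal"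
  assumes "\<And>i. f i \<in> borel_measurable borel"
  shows "(\<integral>\<^sup>+w. (\<Prod>i\<in>UNIV. f i ((w :: real^'d) $ i)) \<partial>lborel) = (\<Prod>i\<in>UNIV. \<integral>\<^sup>+x. f i x \<partial>lborel)"
proof -
  \<comment> \<open>The product formula for \<open>lborel\<close> is indexed by basis vectors;
    \<open>ix\<close> recovers the coordinate belonging to such a vector.\<close>
  define ix where "ix b = (THE i. b = axis i (1::real))" for b :: "real^'d"
  have ix: "ix (axis i 1) = i" for i
    unfolding ix_def by (rule the_equality) (auto simp: axis_eq_axis)
  have B: "(Basis :: (real^'d) set) = (\<lambda>i. axis i 1) ` UNIV"
    by (auto simp: Basis_vec_def)
  have inj: "inj (\<lambda>i. axis i (1::real) :: real^'d)"
    by (auto simp: inj_def axis_eq_axis)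
  show ?thesis
    using nn_integral_lborel_prod[of "\<lambda>b. f (ix b)"] assms
    by (simp add: B prod.reindex[OF inj] ix inner_axis o_def)
qed

lemma measurable_vec_to_PiM:
  "(\<lambda>v. \<lambda>i. v $ i) \<in> gauss_measure \<rightarrow>\<^sub>M PiM UNIV (\<lambda>_::'d::finite. std_normal_distribution)"
proof (rule measurable_PiM_single')
  fix i :: 'd
  have "(\<lambda>v::real^'d. v $ i) \<in> borel_measurable borel"
    by (intro borel_measurable_continuous_onI continuous_intros)
  thus "(\<lambda>v. v $ i) \<in> gauss_measure \<rightarrow>\<^sub>M std_normal_distribution"
    by (simp add: measurable_cong_sets[OF sets_gauss_measure sets_density])
qed (auto simp: space_PiM)

text \<open>A product measure is determined by its values on boxes, and on a box the density
  factorises over the coordinates.\<close>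

lemma std_gauss_eq_distr:
  "(std_gauss :: ('d::finite \<Rightarrow> real) measure) =
     distr gauss_measure (PiM UNIV (\<lambda>_. std_normal_distribution)) (\<lambda>v. \<lambda>i. v $ i)"
  unfolding std_gauss_def
proof (rule sym, rule product_sigma_finite.PiM_eqI)
  show "product_sigma_finite (\<lambda>_::'d. std_normal_distribution)"
    by (intro product_sigma_finite.intro prob_space_imp_sigma_finite prob_space_normal_density) simp
  have [measurable]: "(\<lambda>v. \<lambda>i. v $ i) \<in> gauss_measure \<rightarrow>\<^sub>M PiM UNIV (\<lambda>_::'d. std_normal_distribution)"
    by (rule measurable_vec_to_PiM)
  fix A :: "'d \<Rightarrow> real set" assume A: "\<And>i. i \<in> UNIV \<Longrightarrow> A i \<in> sets std_normal_distribution"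
  have A' [measurable]: "A i \<in> sets borel" for i using A by simp
  have "Pi\<^sub>E UNIV A \<in> sets (PiM UNIV (\<lambda>_. std_normal_distribution))"
    using A by (intro sets_PiM_I_finite) auto
  hence "emeasure (distr gauss_measure (PiM UNIV (\<lambda>_. std_normal_distribution)) (\<lambda>v. \<lambda>i. v $ i)) (Pi\<^sub>E UNIV A) =
     emeasure gauss_measure {v. \<forall>i. v $ i \<in> A i}"
    by (subst emeasure_distr) (auto intro!: arg_cong2[where f = emeasure])
  also have "\<dots> = (\<integral>\<^sup>+v. ennreal (gauss_density v) * indicator {v. \<forall>i. v $ i \<in> A i} v \<partial>lborel)"
    unfolding gauss_measure_def by (subst emeasure_density) auto
  also have "\<dots> = (\<integral>\<^sup>+v. (\<Prod>i\<in>UNIV. ennreal (std_normal_density (v $ i)) * indicator (A i) (v $ i)) \<partial>lborel)"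
    by (intro nn_integral_cong)
       (auto simp: gauss_density_def prod_ennreal prod.distrib indicator_def prod_zero_iff split: if_splits)
  also have "\<dots> = (\<Prod>i\<in>UNIV. \<integral>\<^sup>+x. ennreal (std_normal_density x) * indicator (A i) x \<partial>lborel)"
    by (rule nn_integral_lborel_vec_prod) measurable
  also have "\<dots> = (\<Prod>i\<in>UNIV. emeasure std_normal_distribution (A i))"
    by (intro prod.cong refl) (simp add: emeasure_density)
  finally show "emeasure (distr gauss_measure (PiM UNIV (\<lambda>_. std_normal_distribution)) (\<lambda>v. \<lambda>i. v $ i)) (Pi\<^sub>E UNIV A) =
     (\<Prod>i\<in>UNIV. emeasure std_normal_distribution (A i))" .
qed auto

lemma prob_space_gauss_measure: "prob_space (gauss_measure :: (real^'d::finite) measure)"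
proof
  have "emeasure (gauss_measure :: (real^'d) measure) UNIV = (\<integral>\<^sup>+v. ennreal (gauss_density (v::real^'d)) \<partial>lborel)"
    unfolding gauss_measure_def by (subst emeasure_density) auto
  also have "\<dots> = (\<integral>\<^sup>+v. (\<Prod>i\<in>UNIV. ennreal (std_normal_density ((v::real^'d) $ i))) \<partial>lborel)"
    by (simp add: gauss_density_def prod_ennreal)
  also have "\<dots> = (\<Prod>i\<in>(UNIV::'d set). \<integral>\<^sup>+x. ennreal (std_normal_density x) \<partial>lborel)"
    by (rule nn_integral_lborel_vec_prod) measurable
  also have "\<dots> = 1"
    by (simp add: nn_integral_eq_integral integrable_normal_density integral_normal_density)
  finally show "emeasure (gauss_measure :: (real^'d) measure) (space gauss_measure) = 1" by simp
qed

lemma measure_gauss_measure_UNIV [simp]: "measure (gauss_measure :: (real^'d::finite) measure) UNIV = 1"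
  using prob_space.prob_space[OF prob_space_gauss_measure] by simp

lemma gauss_integrable_const [simp]:
  "integrable (gauss_measure :: (real^'d::finite) measure) (\<lambda>_. c :: real)"
  by (intro finite_measure.integrable_const prob_space.finite_measure prob_space_gauss_measure)

lemma borel_measurable_orthant [measurable]:
  "(\<lambda>w. of_bool (c \<le> (A::real^'d::finite^'e::finite) *v w) :: real) \<in> borel_measurable borel"
proof -
  have "{w. c \<le> A *v w} = (\<Inter>i. {w. c $ i \<le> (A *v w) $ i})"
    by (auto simp: less_eq_vec_def)
  moreover have "closed (\<Inter>i. {w. c $ i \<le> (A *v w) $ i})"
    by (intro closed_INT ballI closed_Collect_le continuous_intros)
  ultimately have "{w. c \<le> A *v w} \<in> sets borel" by simp
  hence "(indicator {w. c \<le> A *v w} :: _ \<Rightarrow> real) \<in> borel_measurable borel"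
    by (rule borel_measurable_indicator)
  also have "(indicator {w. c \<le> A *v w} :: _ \<Rightarrow> real) = (\<lambda>w. of_bool (c \<le> A *v w))"
    by (auto simp: indicator_def)
  finally show ?thesis .
qed

lemma measure_std_gauss_orthant:
  fixes A :: "real^'d::finite^'e::finite"
  shows "measure (std_gauss :: ('d \<Rightarrow> real) measure) {w \<in> space std_gauss. z \<le> A *v (\<chi> i. w i)} =
    (\<integral>w. of_bool (z \<le> A *v w) \<partial>gauss_measure)"
proof -
  let ?P = "PiM UNIV (\<lambda>_::'d. std_normal_distribution)"
  have f [measurable]: "(\<lambda>v. \<lambda>i. v $ i) \<in> gauss_measure \<rightarrow>\<^sub>M ?P"
    by (rule measurable_vec_to_PiM)
  have [measurable]: "(\<lambda>w. w i) \<in> borel_measurable ?P" for i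
    using measurable_component_singleton[of i UNIV "\<lambda>_. std_normal_distribution"]
    by (simp add: measurable_cong_sets[OF refl sets_density])
  have "{w \<in> space ?P. z \<le> A *v (\<chi> i. w i)} = {w \<in> space ?P. \<forall>j. z $ j \<le> (\<Sum>i\<in>UNIV. A $ j $ i * w i)}"
    by (simp add: less_eq_vec_def matrix_vector_mult_def)
  also have "\<dots> \<in> sets ?P"
    by measurable
  finally have "{w \<in> space ?P. z \<le> A *v (\<chi> i. w i)} \<in> sets ?P" .
  hence "measure (std_gauss :: ('d \<Rightarrow> real) measure) {w \<in> space std_gauss. z \<le> A *v (\<chi> i. w i)} =
     measure gauss_measure {w. z \<le> A *v w}"
    unfolding std_gauss_eq_distr
    by (subst measure_distr) (auto intro!: arg_cong2[where f = measure] simp: space_PiM)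
  also have "\<dots> = (\<integral>w. indicator {w. z \<le> A *v w} w \<partial>gauss_measure)"
    by simp
  finally show ?thesis by (simp add: indicator_def of_bool_def)
qed

section \<open>Shifts, dilations and exponential moments of the Gaussian measure\<close>

lemma lborel_integral_affine:
  fixes f :: "'a::euclidean_space \<Rightarrow> real"
  assumes c: "c > 0" and [measurable]: "f \<in> borel_measurable borel"
  shows "(\<integral>x. f x \<partial>lborel) = c ^ DIM('a) * (\<integral>x. f (t + c *\<^sub>R x) \<partial>lborel)"
    and "integrable lborel f \<longleftrightarrow> integrable lborel (\<lambda>x. f (t + c *\<^sub>R x))"
proof -
  have eq: "(lborel :: 'a measure) = density (distr lborel borel (\<lambda>x. t + c *\<^sub>R x)) (\<lambda>_. ennreal (c ^ DIM('a)))"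
    using lborel_affine[of c t] c by simp
  have [measurable]: "(\<lambda>x. t + c *\<^sub>R x) \<in> borel \<rightarrow>\<^sub>M borel" by simp
  show "(\<integral>x. f x \<partial>lborel) = c ^ DIM('a) * (\<integral>x. f (t + c *\<^sub>R x) \<partial>lborel)"
    using c by (subst eq) (simp add: integral_density integral_distr)
  show "integrable lborel f \<longleftrightarrow> integrable lborel (\<lambda>x. f (t + c *\<^sub>R x))"
    using c by (subst eq) (simp add: integrable_density integrable_distr_eq)
qed

lemma gauss_integral_eq:
  fixes F :: "real^'d::finite \<Rightarrow> real"
  assumes [measurable]: "F \<in> borel_measurable borel"
  shows "(\<integral>w. F w \<partial>gauss_measure) = (\<integral>w. gauss_density w * F w \<partial>lborel)"
  unfolding gauss_measure_def by (subst integral_density) auto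

lemma gauss_integrable_iff:
  fixes F :: "real^'d::finite \<Rightarrow> real"
  assumes [measurable]: "F \<in> borel_measurable borel"
  shows "integrable gauss_measure F \<longleftrightarrow> integrable lborel (\<lambda>w. gauss_density w * F w)"
  unfolding gauss_measure_def by (subst integrable_density) auto

text \<open>Cameron-Martin formula: the exponential is the likelihood ratio of W + y against
  W.\<close>

lemma gauss_integral_shift:
  fixes F :: "real^'d::finite \<Rightarrow> real"
  assumes [measurable]: "F \<in> borel_measurable borel"
  shows "(\<integral>w. F (w + y) \<partial>gauss_measure) = (\<integral>w. exp (w \<bullet> y - (norm y)\<^sup>2 / 2) * F w \<partial>gauss_measure)"
proof -
  have "(\<integral>w. F (w + y) \<partial>gauss_measure) = (\<integral>w. gauss_density w * F (w + y) \<partial>lborel)"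
    by (rule gauss_integral_eq) measurable
  also have "\<dots> = (\<integral>w. gauss_density (w - y) * F w \<partial>lborel)"
    by (subst (2) lborel_integral_affine[of 1 _ y]) (simp_all add: add.commute)
  also have "\<dots> = (\<integral>w. gauss_density w * (exp (w \<bullet> y - (norm y)\<^sup>2 / 2) * F w) \<partial>lborel)"
    by (intro Bochner_Integration.integral_cong refl)
       (simp add: gauss_density_eq power2_norm_eq_inner inner_diff field_simps inner_commute flip: exp_add)
  also have "\<dots> = (\<integral>w. exp (w \<bullet> y - (norm y)\<^sup>2 / 2) * F w \<partial>gauss_measure)"
    by (rule gauss_integral_eq[symmetric]) measurable
  finally show ?thesis .
qed

text \<open>The factor is the likelihood ratio of s W against W. Its exponential rate (1 - 1 / s^2)
  / 2 stays below 1 / 2, so it is integrable for every s.\<close>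

lemma gauss_integral_scale:
  fixes F :: "real^'d::finite \<Rightarrow> real"
  assumes [measurable]: "F \<in> borel_measurable borel" and s: "s > 0"
  shows "(\<integral>w. F (s *\<^sub>R w) \<partial>gauss_measure) =
    (\<integral>w. (exp ((norm w)\<^sup>2 * (1 - 1 / s\<^sup>2) / 2) / s ^ CARD('d)) * F w \<partial>gauss_measure)"
proof -
  have "(\<integral>w. F (s *\<^sub>R w) \<partial>gauss_measure) = (\<integral>w. gauss_density w * F (s *\<^sub>R w) \<partial>lborel)"
    by (rule gauss_integral_eq) measurable
  also have "\<dots> = (\<integral>w. gauss_density ((1 / s) *\<^sub>R w) * F w \<partial>lborel) / s ^ CARD('d)"
    using s by (subst (2) lborel_integral_affine[of s _ 0]) simp_all
  also have "\<dots> = (\<integral>w. gauss_density ((1 / s) *\<^sub>R w) * F w / s ^ CARD('d) \<partial>lborel)"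
    by simp
  also have "\<dots> = (\<integral>w. gauss_density w * ((exp ((norm w)\<^sup>2 * (1 - 1 / s\<^sup>2) / 2) / s ^ CARD('d)) * F w) \<partial>lborel)"
    by (intro Bochner_Integration.integral_cong refl)
       (simp add: gauss_density_eq field_simps power_mult_distrib flip: exp_add)
  also have "\<dots> = (\<integral>w. (exp ((norm w)\<^sup>2 * (1 - 1 / s\<^sup>2) / 2) / s ^ CARD('d)) * F w \<partial>gauss_measure)"
    by (rule gauss_integral_eq[symmetric]) measurable
  finally show ?thesis .
qed

text \<open>The weighted density is the density itself evaluated at sqrt (1 - 2 c) w.\<close>

lemma gauss_integrable_exp_norm:
  assumes "c < 1 / 2"
  shows "integrable gauss_measure (\<lambda>w::real^'d::finite. exp (c * (norm w)\<^sup>2))"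
proof -
  have "integrable gauss_measure (\<lambda>w::real^'d. 1 :: real)" by simp
  hence "integrable lborel (gauss_density :: real^'d \<Rightarrow> real)"
    by (subst (asm) gauss_integrable_iff) auto
  hence "integrable lborel (\<lambda>w::real^'d. gauss_density (0 + sqrt (1 - 2 * c) *\<^sub>R w))"
    using assms by (subst (asm) lborel_integral_affine(2)[of "sqrt (1 - 2 * c)" _ 0]) auto
  also have "(\<lambda>w::real^'d. gauss_density (0 + sqrt (1 - 2 * c) *\<^sub>R w)) = (\<lambda>w. gauss_density w * exp (c * (norm w)\<^sup>2))"
    using assms by (auto simp: gauss_density_eq fun_eq_iff power_mult_distrib field_simps simp flip: exp_add)
  finally show ?thesis by (subst gauss_integrable_iff) auto
qed

section \<open>Expansion of the Gaussian likelihood ratios\<close>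

text \<open>The factor is one-sided: a negative argument causes no exponential growth. In the
  dilation ratio only the positive part of the exponent then has to be dominated.\<close>

lemma exp_remainder_2:
  fixes x :: real
  shows "\<bar>exp x - 1 - x\<bar> \<le> x\<^sup>2 / 2 * exp (max 0 x)"
proof (cases "x \<ge> 0")
  case True
  obtain t where t: "\<bar>t\<bar> \<le> \<bar>x\<bar>" "exp x = (\<Sum>m<2. (x ^ m) / fact m) + (exp t / fact 2) * x ^ 2"
    using Maclaurin_exp_le[of x 2] by auto
  have "exp x - 1 - x = x\<^sup>2 / 2 * exp t"
    unfolding t(2) by (simp add: eval_nat_numeral)
  moreover have "x\<^sup>2 / 2 * exp t \<le> x\<^sup>2 / 2 * exp x"
    using t(1) True by (intro mult_left_mono) auto
  moreover have "0 \<le> x\<^sup>2 / 2 * exp t" by simp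
  ultimately show ?thesis using True unfolding max_absorb2[OF True] by linarith
next
  case False
  define y where "y = - x"
  have y: "y \<ge> 0" using False by (simp add: y_def)
  have pos: "0 \<le> 1 - y + y\<^sup>2 / 2"
    using zero_le_power2[of "y - 1"] by (simp add: power2_diff)
  \<comment> \<open>The product is 1 + y^4 / 4, which turns the quadratic lower bound for exp y into
    an upper bound for exp (- y).\<close>
  have "1 \<le> (1 - y + y\<^sup>2 / 2) * (1 + y + y\<^sup>2 / 2)"
  proof -
    have "(1 - y + y\<^sup>2 / 2) * (1 + y + y\<^sup>2 / 2) = 1 + (y * y)\<^sup>2 / 4"
      by (simp add: algebra_simps power2_eq_square)
    thus ?thesis by simp
  qed
  also have "\<dots> \<le> (1 - y + y\<^sup>2 / 2) * exp y"
    by (intro mult_left_mono exp_lower_Taylor_quadratic pos y)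
  finally have "exp x \<le> 1 + x + x\<^sup>2 / 2"
    by (simp add: y_def exp_minus field_simps)
  moreover have "1 + x \<le> exp x" by simp
  ultimately have "\<bar>exp x - 1 - x\<bar> \<le> x\<^sup>2 / 2" by linarith
  thus ?thesis using False by (simp add: max_def)
qed

lemma exp_remainder_3:
  fixes x :: real
  shows "\<bar>exp x - 1 - x - x\<^sup>2 / 2\<bar> \<le> \<bar>x\<bar> ^ 3 * exp \<bar>x\<bar>"
proof -
  obtain t where t: "\<bar>t\<bar> \<le> \<bar>x\<bar>" "exp x = (\<Sum>m<3. (x ^ m) / fact m) + (exp t / fact 3) * x ^ 3"
    using Maclaurin_exp_le[of x 3] by auto
  have "exp x - 1 - x - x\<^sup>2 / 2 = (exp t / 6) * x ^ 3"
    unfolding t(2) by (simp add: eval_nat_numeral)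
  hence "\<bar>exp x - 1 - x - x\<^sup>2 / 2\<bar> = exp t / 6 * \<bar>x\<bar> ^ 3"
    by (simp only: abs_mult power_abs abs_divide abs_exp_cancel abs_numeral)
  also have "\<dots> \<le> exp \<bar>x\<bar> * \<bar>x\<bar> ^ 3"
  proof (intro mult_right_mono)
    have "exp t / 6 \<le> exp t" by simp
    also have "\<dots> \<le> exp \<bar>x\<bar>" using t(1) by simp
    finally show "exp t / 6 \<le> exp \<bar>x\<bar>" .
  qed auto
  finally show ?thesis by (simp add: mult.commute)
qed

text \<open>Complete the square in (k + N) r. The rate 1 / 16 is small enough for all later weights,
  at most 3 / 8, to stay below the integrability threshold 1 / 2.\<close>

lemma poly_exp_le_exp_square:
  fixes r N :: real
  assumes "r \<ge> 0"
  shows "(1 + r) ^ k * exp (N * r) \<le> exp (4 * (real k + N)\<^sup>2) * exp (r\<^sup>2 / 16)"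
proof -
  have "(1 + r) ^ k \<le> exp r ^ k"
    using assms by (intro power_mono) auto
  hence "(1 + r) ^ k * exp (N * r) \<le> exp (real k * r) * exp (N * r)"
    by (simp add: exp_of_nat_mult mult_right_mono)
  also have "\<dots> = exp ((real k + N) * r)"
    by (simp add: distrib_right exp_add)
  also have "(real k + N) * r \<le> 4 * (real k + N)\<^sup>2 + r\<^sup>2 / 16"
  proof -
    have *: "4 * c\<^sup>2 + r\<^sup>2 / 16 - c * r = (r / 4 - 2 * c)\<^sup>2" for c
      by (simp add: power2_eq_square algebra_simps)
    show ?thesis using zero_le_power2[of "r / 4 - 2 * (real k + N)"] unfolding *[symmetric] by linarith
  qed
  finally show ?thesis by (simp add: exp_add)
qed

lemma harm_le_one_plus_ln:
  assumes "n > 0"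
  shows "(harm n :: real) \<le> 1 + ln (real n)"
proof -
  obtain k where n: "n = Suc k" using assms by (cases n) auto
  have "harm (Suc k) - ln (real (Suc k)) \<le> harm (Suc 0) - ln (real (Suc 0))"
    using decseqD[OF decseq_harm_diff_ln, of 0 k] by simp
  thus ?thesis by (simp add: n harm_expand)
qed

text \<open>With a^2 = n - 1 - k and b^2 = k + 1 one has a^2 + b^2 = n, so sqrt n \<le> a + b. After
  multiplication by sqrt n each summand is then bounded by multiples of 1 / a^2 and 1 / b^2, and two
  harmonic sums remain.\<close>

lemma sum_inverse_mult_sqrt_le:
  assumes "n > 0"
  shows "(\<Sum>k<n-1. 1 / (real (n - 1 - k) * sqrt (real k + 1))) \<le> 2 * (1 + ln (real n)) / sqrt (real n)"
proof -
  define N where "N = n - 1"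
  have n: "n = Suc N" using assms by (simp add: N_def)
  have "sqrt (real n) * (1 / (real (N - k) * sqrt (real k + 1))) \<le>
        3 / 2 * (1 / real (N - k)) + 1 / 2 * (1 / (real k + 1))" if k: "k < N" for k
  proof -
    define a b where "a = sqrt (real (N - k))" and "b = sqrt (real k + 1)"
    have ab: "a > 0" "b > 0" using k by (auto simp: a_def b_def)
    have a2: "real (N - k) = a\<^sup>2" and b2: "real k + 1 = b\<^sup>2" by (auto simp: a_def b_def)
    have "sqrt (real n) = sqrt (a\<^sup>2 + b\<^sup>2)"
      using k by (simp add: n flip: a2 b2)
    also have "\<dots> \<le> a + b"
      using ab by (simp add: sqrt_sum_squares_le_sum)
    finally have "sqrt (real n) * (1 / (a\<^sup>2 * b)) \<le> (a + b) * (1 / (a\<^sup>2 * b))"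
      using ab by (intro mult_right_mono) auto
    also have "\<dots> = 1 / a\<^sup>2 + (1 / a) * (1 / b)"
      using ab by (simp add: field_simps power2_eq_square)
    also have "(1 / a) * (1 / b) \<le> ((1 / a)\<^sup>2 + (1 / b)\<^sup>2) / 2"
      using zero_le_power2[of "1 / a - 1 / b"] by (simp add: power2_diff)
    finally have "sqrt (real n) * (1 / (a\<^sup>2 * b)) \<le> 3 / 2 * (1 / a\<^sup>2) + 1 / 2 * (1 / b\<^sup>2)"
      by (simp add: power_divide add_divide_distrib)
    thus ?thesis unfolding a2 b_def[symmetric] unfolding b2 .
  qed
  hence "(\<Sum>k<N. sqrt (real n) * (1 / (real (N - k) * sqrt (real k + 1)))) \<le>
    (\<Sum>k<N. 3 / 2 * (1 / real (N - k)) + 1 / 2 * (1 / (real k + 1)))"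
    by (intro sum_mono) auto
  also have "\<dots> = 3 / 2 * (\<Sum>k<N. 1 / real (N - k)) + 1 / 2 * (\<Sum>k<N. 1 / (real k + 1))"
    by (simp add: sum.distrib sum_distrib_left)
  also have "(\<Sum>k<N. 1 / (real k + 1)) = harm N"
    by (simp add: harm_altdef inverse_eq_divide add.commute)
  also have "(\<Sum>k<N. 1 / real (N - k)) = (\<Sum>k<N. 1 / (real k + 1))"
    by (subst sum.nat_diff_reindex[symmetric]) (intro sum.cong refl, auto simp: Suc_diff_Suc of_nat_diff)
  also have "\<dots> = harm N"
    by (simp add: harm_altdef inverse_eq_divide add.commute)
  also have "3 / 2 * harm N + 1 / 2 * harm N = 2 * (harm N :: real)" by simp
  also have "(harm N :: real) \<le> harm n"
    by (rule harm_mono) (simp add: n)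
  also have "(harm n :: real) \<le> 1 + ln (real n)"
    by (rule harm_le_one_plus_ln) (simp add: n)
  finally have "sqrt (real n) * (\<Sum>k<N. 1 / (real (N - k) * sqrt (real k + 1))) \<le> 2 * (1 + ln (real n))"
    by (simp add: sum_distrib_left)
  thus ?thesis using assms by (simp add: N_def field_simps)
qed

text \<open>The ratio is exp \<open>L\<close>, and \<open>L\<close> agrees with \<epsilon>^2 (r^2 -
  d) / 2 up to order \<epsilon>^4. The bound is weakened to \<epsilon>^3 to match the shift
  ratio.\<close>

lemma gauss_scale_factor_bound:
  fixes r \<epsilon> :: real
  assumes r: "r \<ge> 0" and \<epsilon>: "\<epsilon> > 0" "\<epsilon> \<le> 1" and d: "d \<ge> 1"
  shows "\<bar>exp (r\<^sup>2 * (1 - 1 / (sqrt (1 + \<epsilon>\<^sup>2))\<^sup>2) / 2) / sqrt (1 + \<epsilon>\<^sup>2) ^ d - (1 + \<epsilon>\<^sup>2 * (r\<^sup>2 - real d) / 2)\<bar>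
    \<le> \<epsilon> ^ 3 * (2 * (real d)\<^sup>2 * (1 + r) ^ 4 * exp (r\<^sup>2 / 4))"
proof -
  define \<theta> where "\<theta> = \<epsilon>\<^sup>2"
  have \<theta>: "\<theta> > 0" "\<theta> \<le> 1" using \<epsilon> by (auto simp: \<theta>_def power_le_one)
  define P where "P = r\<^sup>2 * (\<theta> / (1 + \<theta>))"
  define E where "E = real d * ln (1 + \<theta>)"
  define L where "L = (P - E) / 2"
  have "sqrt (1 + \<theta>) ^ d = exp (real d / 2 * ln (1 + \<theta>))"
    using \<theta> by (simp add: powr_half_sqrt[symmetric] powr_def exp_of_nat_mult[symmetric])
  moreover have "1 - 1 / (1 + \<theta>) = \<theta> / (1 + \<theta>)"
    using \<theta> by (simp add: field_simps)
  ultimately have eq: "exp (r\<^sup>2 * (1 - 1 / (sqrt (1 + \<epsilon>\<^sup>2))\<^sup>2) / 2) / sqrt (1 + \<epsilon>\<^sup>2) ^ d = exp L"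
    using \<theta> by (simp add: L_def P_def E_def diff_divide_distrib exp_diff flip: \<theta>_def)
  have ln1: "0 \<le> ln (1 + \<theta>)" "ln (1 + \<theta>) \<le> \<theta>"
    using \<theta> ln_add_one_self_le_self[of \<theta>] by auto
  have ln2: "\<theta> - \<theta>\<^sup>2 \<le> ln (1 + \<theta>)"
    using ln_one_plus_pos_lower_bound[of \<theta>] \<theta> by simp
  have frac: "0 \<le> \<theta> / (1 + \<theta>)" "\<theta> / (1 + \<theta>) \<le> \<theta>" "\<theta> / (1 + \<theta>) \<le> 1 / 2" "\<theta> - \<theta>\<^sup>2 \<le> \<theta> / (1 + \<theta>)"
    using \<theta> by (auto simp: field_simps power2_eq_square)
  define R where "R = r\<^sup>2 + real d"
  have R: "R \<ge> 1" using d by (simp add: R_def add_increasing)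
  have r1: "0 \<le> P" "P \<le> r\<^sup>2 * \<theta>" "P \<le> r\<^sup>2 * (1 / 2)" "r\<^sup>2 * (\<theta> - \<theta>\<^sup>2) \<le> P"
    using frac unfolding P_def by (auto intro!: mult_left_mono mult_nonneg_nonneg simp del: times_divide_eq_right)
  have d1: "0 \<le> E" "E \<le> real d * \<theta>" "real d * (\<theta> - \<theta>\<^sup>2) \<le> E"
    using ln1 ln2 unfolding E_def by (auto intro!: mult_left_mono)
  have \<theta>R: "\<theta> * R = r\<^sup>2 * \<theta> + real d * \<theta>" "\<theta>\<^sup>2 * R = r\<^sup>2 * \<theta>\<^sup>2 + real d * \<theta>\<^sup>2"
    by (simp_all add: R_def algebra_simps)
  have absL: "\<bar>L\<bar> \<le> \<theta> * R"
    using r1(1,2) d1(1,2) unfolding L_def \<theta>R by (intro abs_leI) (simp_all add: field_simps)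
  \<comment> \<open>Here \<epsilon> \<le> 1 enters: \<theta> / (1 + \<theta>) \<le> 1 / 2 limits the
    exponential weight to exp (r^2 / 4).\<close>
  have maxL: "max 0 L \<le> r\<^sup>2 / 4"
    using r1(1,3) d1(1) unfolding L_def by (simp add: max_def)
  have diffL: "\<bar>L - \<theta> * (r\<^sup>2 - real d) / 2\<bar> \<le> \<theta>\<^sup>2 * R"
  proof -
    have eq: "L - \<theta> * (r\<^sup>2 - real d) / 2 = ((P - r\<^sup>2 * \<theta>) - (E - real d * \<theta>)) / 2"
      by (simp add: L_def field_simps)
    have nn: "0 \<le> r\<^sup>2 * \<theta>\<^sup>2" "0 \<le> real d * \<theta>\<^sup>2" by auto
    show ?thesis
      using r1(2,4) d1(2,3) nn unfolding eq \<theta>R right_diff_distrib[of "r\<^sup>2"] right_diff_distrib[of "real d"]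
      by (intro abs_leI) (simp_all add: field_simps)
  qed
  have "\<bar>exp L - 1 - L\<bar> \<le> L\<^sup>2 / 2 * exp (max 0 L)"
    by (rule exp_remainder_2)
  also have "\<dots> \<le> (\<theta> * R)\<^sup>2 * exp (r\<^sup>2 / 4)"
  proof (intro mult_mono)
    have "L\<^sup>2 \<le> (\<theta> * R)\<^sup>2" using absL by (simp add: abs_le_square_iff[symmetric])
    thus "L\<^sup>2 / 2 \<le> (\<theta> * R)\<^sup>2" using zero_le_power2[of "\<theta> * R"] by linarith
  qed (use maxL in auto)
  finally have "\<bar>exp L - 1 - L\<bar> \<le> \<theta>\<^sup>2 * (R\<^sup>2 * exp (r\<^sup>2 / 4))"
    by (simp add: power_mult_distrib mult_ac)
  hence "\<bar>exp L - (1 + \<theta> * (r\<^sup>2 - real d) / 2)\<bar> \<le> \<theta>\<^sup>2 * (R\<^sup>2 * exp (r\<^sup>2 / 4)) + \<theta>\<^sup>2 * R"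
    using diffL by linarith
  also have "\<dots> = \<theta>\<^sup>2 * (R\<^sup>2 * exp (r\<^sup>2 / 4) + R)"
    by (simp add: distrib_left)
  also have "\<dots> \<le> \<epsilon> ^ 3 * (2 * (real d)\<^sup>2 * (1 + r) ^ 4 * exp (r\<^sup>2 / 4))"
  proof (rule mult_mono)
    have "\<epsilon> ^ 3 * \<epsilon> \<le> \<epsilon> ^ 3 * 1" using \<epsilon> by (intro mult_left_mono) auto
    thus "\<theta>\<^sup>2 \<le> \<epsilon> ^ 3" by (simp add: \<theta>_def eval_nat_numeral mult_ac)
    have "R * 1 \<le> R * (R * exp (r\<^sup>2 / 4))"
      using R by (intro mult_left_mono) (auto intro: mult_ge1_I)
    hence "R\<^sup>2 * exp (r\<^sup>2 / 4) + R \<le> 2 * (R\<^sup>2 * exp (r\<^sup>2 / 4))"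
      by (simp add: power2_eq_square mult_ac)
    also have "R\<^sup>2 \<le> (real d * (1 + r)\<^sup>2)\<^sup>2"
    proof (intro power_mono)
      have "r\<^sup>2 \<le> real d * r\<^sup>2" "0 \<le> real d * r"
        using d r by (auto simp: mult_le_cancel_right1)
      thus "R \<le> real d * (1 + r)\<^sup>2"
        by (simp add: R_def power2_sum algebra_simps)
    qed (use R in auto)
    finally show "R\<^sup>2 * exp (r\<^sup>2 / 4) + R \<le> 2 * (real d)\<^sup>2 * (1 + r) ^ 4 * exp (r\<^sup>2 / 4)"
      by (simp add: power_mult_distrib mult_ac mult_right_mono flip: power_mult)
    show "0 \<le> R\<^sup>2 * exp (r\<^sup>2 / 4) + R" using R by (intro add_nonneg_nonneg mult_nonneg_nonneg) auto
  qed (use \<epsilon> in auto)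
  finally show ?thesis unfolding eq \<theta>_def .
qed

text \<open>The polynomial is the start of the Hermite generating series: it collects the terms of 1
  + x + x^2 / 2 up to \<epsilon>^2, where x is the exponent.\<close>

lemma gauss_shift_factor_bound:
  fixes w v :: "'v::real_inner" and \<epsilon> M :: real
  assumes \<epsilon>: "\<epsilon> > 0" "\<epsilon> \<le> 1" and M: "M \<ge> 1" "norm v \<le> M"
  shows "\<bar>exp (w \<bullet> (\<epsilon> *\<^sub>R v) - (norm (\<epsilon> *\<^sub>R v))\<^sup>2 / 2)
      - (1 + \<epsilon> * (w \<bullet> v) + \<epsilon>\<^sup>2 * ((w \<bullet> v)\<^sup>2 - (norm v)\<^sup>2) / 2)\<bar>
    \<le> \<epsilon> ^ 3 * (2 * M ^ 6 * exp (M\<^sup>2) * ((1 + norm w) ^ 3 * exp (M\<^sup>2 * norm w)))"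
proof -
  define a b where "a = w \<bullet> v" and "b = (norm v)\<^sup>2"
  define x where "x = \<epsilon> * a - \<epsilon>\<^sup>2 * b / 2"
  define r where "r = norm w"
  have r: "r \<ge> 0" by (simp add: r_def)
  have b: "0 \<le> b" "b \<le> M\<^sup>2" using M by (auto simp: b_def intro: power_mono)
  have "\<bar>a\<bar> \<le> norm w * norm v" by (simp add: a_def Cauchy_Schwarz_ineq2)
  also have "\<dots> \<le> r * M" using M by (auto simp: r_def intro: mult_left_mono)
  finally have a: "\<bar>a\<bar> \<le> r * M" .
  have MM: "M \<le> M\<^sup>2" using M by (simp add: power2_eq_square)
  have aM: "\<bar>a\<bar> \<le> r * M\<^sup>2" using a r MM by (meson mult_left_mono order_trans)
  \<comment> \<open>\<open>Q\<close> dominates both the inner product \<open>a\<close> and the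
    square \<open>b\<close>, so \<bar>x\<bar> \<le> \<epsilon> Q; the Taylor remainder and the terms
    of x^2 / 2 beyond \<epsilon>^2 are then both controlled by Q^3 exp Q.\<close>
  define Q where "Q = M\<^sup>2 * (1 + r)"
  have Q: "Q \<ge> 1" using M r by (auto simp: Q_def intro!: mult_ge1_I one_le_power)
  have "\<epsilon>\<^sup>2 * b \<le> \<epsilon> * M\<^sup>2"
    using \<epsilon> b by (intro mult_mono) (auto simp: power2_eq_square mult_left_le)
  moreover have "\<bar>\<epsilon> * a\<bar> \<le> \<epsilon> * (r * M\<^sup>2)"
    using \<epsilon> aM by (auto simp: abs_mult)
  moreover have "0 \<le> \<epsilon>\<^sup>2 * b" using b by simp
  ultimately have x: "\<bar>x\<bar> \<le> \<epsilon> * Q"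
    unfolding x_def Q_def by (simp add: algebra_simps abs_le_iff)
  have xQ: "\<bar>x\<bar> \<le> Q"
    using x \<epsilon> Q mult_right_mono[of \<epsilon> 1 Q] by linarith
  have "\<bar>exp x - 1 - x - x\<^sup>2 / 2\<bar> \<le> \<bar>x\<bar> ^ 3 * exp \<bar>x\<bar>"
    by (rule exp_remainder_3)
  also have "\<dots> \<le> (\<epsilon> * Q) ^ 3 * exp Q"
    using x xQ \<epsilon> Q by (intro mult_mono power_mono) auto
  finally have 1: "\<bar>exp x - 1 - x - x\<^sup>2 / 2\<bar> \<le> \<epsilon> ^ 3 * (Q ^ 3 * exp Q)"
    by (simp add: power_mult_distrib mult.assoc)
  have "x\<^sup>2 / 2 - \<epsilon>\<^sup>2 * a\<^sup>2 / 2 = \<epsilon> ^ 3 * (\<epsilon> * b\<^sup>2 / 8 - a * b / 2)"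
    by (simp add: x_def power2_eq_square eval_nat_numeral field_simps)
  hence "\<bar>x\<^sup>2 / 2 - \<epsilon>\<^sup>2 * a\<^sup>2 / 2\<bar> = \<epsilon> ^ 3 * \<bar>\<epsilon> * b\<^sup>2 / 8 - a * b / 2\<bar>"
    using \<epsilon> by (simp add: abs_mult)
  also have "\<dots> \<le> \<epsilon> ^ 3 * Q\<^sup>2"
  proof (rule mult_left_mono)
    have "\<epsilon> * b\<^sup>2 \<le> 1 * (M\<^sup>2)\<^sup>2"
      using \<epsilon> b by (intro mult_mono power_mono) auto
    moreover have "\<bar>a * b\<bar> \<le> (r * M\<^sup>2) * M\<^sup>2"
      unfolding abs_mult using aM b r by (intro mult_mono) auto
    moreover have "0 \<le> \<epsilon> * b\<^sup>2" using \<epsilon> by simp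
    ultimately have "\<bar>\<epsilon> * b\<^sup>2 / 8 - a * b / 2\<bar> \<le> (M\<^sup>2)\<^sup>2 + (r * M\<^sup>2) * M\<^sup>2"
      by linarith
    also have "\<dots> = Q * M\<^sup>2" by (simp add: Q_def algebra_simps power2_eq_square)
    also have "\<dots> \<le> Q * Q" using Q r M by (intro mult_left_mono) (auto simp: Q_def algebra_simps)
    finally show "\<bar>\<epsilon> * b\<^sup>2 / 8 - a * b / 2\<bar> \<le> Q\<^sup>2" by (simp add: power2_eq_square)
  qed (use \<epsilon> in auto)
  also have "\<dots> \<le> \<epsilon> ^ 3 * (Q ^ 3 * exp Q)"
  proof (rule mult_left_mono)
    have "Q\<^sup>2 * 1 \<le> Q\<^sup>2 * (Q * exp Q)" using Q by (intro mult_left_mono) (auto intro: mult_ge1_I)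
    thus "Q\<^sup>2 \<le> Q ^ 3 * exp Q" by (simp add: eval_nat_numeral mult_ac)
  qed (use \<epsilon> in auto)
  finally have "\<bar>exp x - (1 + \<epsilon> * a + \<epsilon>\<^sup>2 * (a\<^sup>2 - b) / 2)\<bar> \<le> 2 * (\<epsilon> ^ 3 * (Q ^ 3 * exp Q))"
    using 1 unfolding x_def by (simp add: field_simps)
  also have "\<dots> = \<epsilon> ^ 3 * (2 * M ^ 6 * exp (M\<^sup>2) * ((1 + r) ^ 3 * exp (M\<^sup>2 * r)))"
  proof -
    have "exp Q = exp (M\<^sup>2) * exp (M\<^sup>2 * r)"
      by (simp add: Q_def distrib_left exp_add)
    moreover have "Q ^ 3 = M ^ 6 * (1 + r) ^ 3"
      by (simp add: Q_def power_mult_distrib flip: power_mult)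
    ultimately show ?thesis by simp
  qed
  finally show ?thesis
    by (simp add: x_def a_def b_def r_def power_mult_distrib)
qed

section \<open>A Berry-Esseen bound for orthants\<close>

lemma integrable_mult_bounded:
  fixes G F :: "'a \<Rightarrow> real"
  assumes "integrable M G" "F \<in> borel_measurable M" "\<And>x. \<bar>F x\<bar> \<le> 1"
  shows "integrable M (\<lambda>x. G x * F x)"
proof (rule Bochner_Integration.integrable_bound[OF assms(1)])
  show "AE x in M. norm (G x * F x) \<le> norm (G x)"
    using assms(3) by (intro AE_I2) (auto simp: abs_mult mult_left_le)
qed (use assms in measurable)

text \<open>Counts the bounding hyperplanes within distance \<open>L\<close> of \<open>u\<close>.
  Zero rows are left out: such a constraint does not depend on \<open>u\<close>, and the walk
  projected on it has no variance.\<close>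

definition near_boundary :: "real^'d::finite^'e::finite \<Rightarrow> real^'e \<Rightarrow> real \<Rightarrow> real^'d \<Rightarrow> real" where
  "near_boundary A c L u = (\<Sum>t | A $ t \<noteq> 0. of_bool (\<bar>A $ t \<bullet> u - c $ t\<bar> \<le> norm (A $ t) * L))"

lemma near_boundary_nonneg: "0 \<le> near_boundary A c L u"
  by (auto simp: near_boundary_def intro: sum_nonneg)

text \<open>If the indicators differ, some linear form crosses its threshold under the displacement
  \<open>v\<close>, so it was within norm (A $ t) * norm v of that threshold.\<close>

lemma orthant_diff_le_near_boundary:
  fixes A :: "real^'d::finite^'e::finite"
  shows "\<bar>of_bool (c \<le> A *v (u + v)) - of_bool (c \<le> A *v u)\<bar> \<le> near_boundary A c (norm v) u"
proof (cases "(c \<le> A *v (u + v)) = (c \<le> A *v u)")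
  case False
  then obtain t where t: "(c $ t \<le> A $ t \<bullet> u + A $ t \<bullet> v) \<noteq> (c $ t \<le> A $ t \<bullet> u)"
    by (auto simp: less_eq_vec_def matrix_vector_mul_component inner_add_right)
  hence nz: "A $ t \<noteq> 0" by auto
  have "\<bar>A $ t \<bullet> u - c $ t\<bar> \<le> \<bar>A $ t \<bullet> v\<bar>" using t by linarith
  also have "\<dots> \<le> norm (A $ t) * norm v" by (rule Cauchy_Schwarz_ineq2)
  finally have "1 \<le> (of_bool (\<bar>A $ t \<bullet> u - c $ t\<bar> \<le> norm (A $ t) * norm v) :: real)" by simp
  also have "\<dots> \<le> near_boundary A c (norm v) u"
    unfolding near_boundary_def
    by (rule member_le_sum[of t _ "\<lambda>t. of_bool (\<bar>A $ t \<bullet> u - c $ t\<bar> \<le> norm (A $ t) * norm v)"])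
       (use nz in auto)
  finally show ?thesis using False by auto
qed (auto simp: near_boundary_nonneg)

text \<open>Mean zero and identity covariance, expressed by linear functionals because the walk is
  used through its projections.\<close>

definition isotropic_walk :: "('b::finite \<Rightarrow> real) \<Rightarrow> ('b \<Rightarrow> real^'d::finite) \<Rightarrow> bool" where
  "isotropic_walk q \<xi> \<longleftrightarrow> (\<forall>x. q x \<ge> 0) \<and> (\<Sum>x\<in>UNIV. q x) = 1 \<and>
     (\<forall>c. (\<Sum>x\<in>UNIV. q x * (c \<bullet> \<xi> x)) = 0) \<and> (\<forall>c. (\<Sum>x\<in>UNIV. q x * (c \<bullet> \<xi> x)\<^sup>2) = (norm c)\<^sup>2)"

lemma isotropic_walkD:
  assumes "isotropic_walk q \<xi>"
  shows "q x \<ge> 0" "(\<Sum>x\<in>UNIV. q x) = 1" "(\<Sum>x\<in>UNIV. q x * (c \<bullet> \<xi> x)) = 0"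
    "(\<Sum>x\<in>UNIV. q x * (c \<bullet> \<xi> x)\<^sup>2) = (norm c)\<^sup>2"
  using assms by (auto simp: isotropic_walk_def)

lemma isotropic_walk_second_moment:
  fixes \<xi> :: "'b::finite \<Rightarrow> real^'d::finite"
  assumes iso: "isotropic_walk q \<xi>"
  shows "(\<Sum>x\<in>UNIV. q x * (norm (\<xi> x))\<^sup>2) = real CARD('d)"
proof -
  have "(\<Sum>x\<in>UNIV. q x * (norm (\<xi> x))\<^sup>2) = (\<Sum>x\<in>UNIV. \<Sum>i\<in>UNIV. q x * (axis i 1 \<bullet> \<xi> x)\<^sup>2)"
    by (simp add: power2_norm_vec inner_axis' sum_distrib_left)
  also have "\<dots> = (\<Sum>i\<in>(UNIV :: 'd set). \<Sum>x\<in>UNIV. q x * (axis i 1 \<bullet> \<xi> x)\<^sup>2)"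
    by (rule sum.swap)
  also have "\<dots> = real CARD('d)"
    by (simp add: isotropic_walkD(4)[OF iso])
  finally show ?thesis .
qed

lemma norm_step_bound:
  fixes \<xi> :: "'b::finite \<Rightarrow> 'v::real_normed_vector"
  shows "\<exists>M\<ge>1. \<forall>x. norm (\<xi> x) \<le> M"
proof (intro exI conjI allI)
  show "1 \<le> 1 + (\<Sum>x\<in>UNIV. norm (\<xi> x))" by (simp add: sum_nonneg)
  fix x
  have "norm (\<xi> x) \<le> (\<Sum>x\<in>UNIV. norm (\<xi> x))" by (rule member_le_sum) auto
  thus "norm (\<xi> x) \<le> 1 + (\<Sum>x\<in>UNIV. norm (\<xi> x))" by simp
qed

text \<open>With \<open>\<epsilon> = 1 / \<surd>m\<close>, the difference of the densities with respect to the law of \<open>\<surd>m W\<close>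
  of \<open>\<surd>m W\<close> plus one walk step and of \<open>\<surd>m W\<close> plus one Gaussian step.\<close>

definition ratio_diff :: "('b::finite \<Rightarrow> real) \<Rightarrow> ('b \<Rightarrow> real^'d::finite) \<Rightarrow> real \<Rightarrow> real^'d \<Rightarrow> real" where
  "ratio_diff q \<xi> \<epsilon> w = (\<Sum>x\<in>UNIV. q x * exp (w \<bullet> (\<epsilon> *\<^sub>R \<xi> x) - (norm (\<epsilon> *\<^sub>R \<xi> x))\<^sup>2 / 2))
     - exp ((norm w)\<^sup>2 * (1 - 1 / (sqrt (1 + \<epsilon>\<^sup>2))\<^sup>2) / 2) / sqrt (1 + \<epsilon>\<^sup>2) ^ CARD('d)"

text \<open>In the averaged shift expansion the linear term vanishes, and isotropy turns the
  quadratic one into that of the dilation ratio. Only third-order remainders survive.\<close>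

lemma ratio_diff_bound:
  fixes \<xi> :: "'b::finite \<Rightarrow> real^'d::finite"
  assumes iso: "isotropic_walk q \<xi>"
  shows "\<exists>K\<ge>0. \<forall>\<epsilon> w. 0 < \<epsilon> \<longrightarrow> \<epsilon> \<le> 1 \<longrightarrow> \<bar>ratio_diff q \<xi> \<epsilon> w\<bar> \<le> \<epsilon> ^ 3 * (K * exp (5 / 16 * (norm w)\<^sup>2))"
proof -
  note q_nonneg = isotropic_walkD(1)[OF iso] and q_sum = isotropic_walkD(2)[OF iso]
    and mean = isotropic_walkD(3)[OF iso] and cov = isotropic_walkD(4)[OF iso]
  obtain M where M: "M \<ge> 1" "\<And>x. norm (\<xi> x) \<le> M" using norm_step_bound by blast
  \<comment> \<open>The exponents 3 and 4 are the powers of 1 + norm w in the two remainders. Their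
    weights 1 / 16 and 1 / 16 + 1 / 4 are both at most 5 / 16.\<close>
  define K1 where "K1 = 2 * M ^ 6 * exp (M\<^sup>2) * exp (4 * (3 + M\<^sup>2)\<^sup>2)"
  define K2 where "K2 = 2 * (real CARD('d))\<^sup>2 * exp (4 * (real 4 + 0)\<^sup>2)"
  have nn: "K1 \<ge> 0" "K2 \<ge> 0" using M by (auto simp: K1_def K2_def)
  have "\<bar>ratio_diff q \<xi> \<epsilon> w\<bar> \<le> \<epsilon> ^ 3 * ((K1 + K2) * exp (5 / 16 * (norm w)\<^sup>2))" if \<epsilon>: "0 < \<epsilon>" "\<epsilon> \<le> 1" for \<epsilon> w
  proof -
    let ?r = "norm w"
    define main where "main = 1 + \<epsilon>\<^sup>2 * (?r\<^sup>2 - real CARD('d)) / 2"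
    define e where "e x = exp (w \<bullet> (\<epsilon> *\<^sub>R \<xi> x) - (norm (\<epsilon> *\<^sub>R \<xi> x))\<^sup>2 / 2)" for x
    define p where "p x = 1 + \<epsilon> * (w \<bullet> \<xi> x) + \<epsilon>\<^sup>2 * ((w \<bullet> \<xi> x)\<^sup>2 - (norm (\<xi> x))\<^sup>2) / 2" for x
    have "(\<Sum>x\<in>UNIV. q x * p x) = (\<Sum>x\<in>UNIV. q x) + \<epsilon> * (\<Sum>x\<in>UNIV. q x * (w \<bullet> \<xi> x))
       + \<epsilon>\<^sup>2 / 2 * ((\<Sum>x\<in>UNIV. q x * (w \<bullet> \<xi> x)\<^sup>2) - (\<Sum>x\<in>UNIV. q x * (norm (\<xi> x))\<^sup>2))"
      unfolding sum_distrib_left sum_subtractf[symmetric] sum.distrib[symmetric] p_def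
      by (intro sum.cong refl) (simp add: field_simps)
    also have "\<dots> = main"
      by (simp add: q_sum mean cov isotropic_walk_second_moment[OF iso] main_def)
    finally have p: "(\<Sum>x\<in>UNIV. q x * p x) = main" .
    have "\<bar>(\<Sum>x\<in>UNIV. q x * e x) - main\<bar> = \<bar>\<Sum>x\<in>UNIV. q x * (e x - p x)\<bar>"
      by (simp add: right_diff_distrib sum_subtractf p)
    also have "\<dots> \<le> (\<Sum>x\<in>UNIV. \<bar>q x * (e x - p x)\<bar>)"
      by (rule sum_abs)
    also have "\<dots> \<le> (\<Sum>x\<in>UNIV. q x * (\<epsilon> ^ 3 * (2 * M ^ 6 * exp (M\<^sup>2) * ((1 + ?r) ^ 3 * exp (M\<^sup>2 * ?r)))))"
    proof (intro sum_mono)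
      fix x
      show "\<bar>q x * (e x - p x)\<bar> \<le> q x * (\<epsilon> ^ 3 * (2 * M ^ 6 * exp (M\<^sup>2) * ((1 + ?r) ^ 3 * exp (M\<^sup>2 * ?r))))"
        unfolding abs_mult e_def p_def abs_of_nonneg[OF q_nonneg]
        by (intro mult_left_mono gauss_shift_factor_bound \<epsilon> M q_nonneg)
    qed
    also have "\<dots> = \<epsilon> ^ 3 * (2 * M ^ 6 * exp (M\<^sup>2) * ((1 + ?r) ^ 3 * exp (M\<^sup>2 * ?r)))"
      by (simp add: q_sum flip: sum_distrib_right)
    also have "\<dots> \<le> \<epsilon> ^ 3 * (2 * M ^ 6 * exp (M\<^sup>2) * (exp (4 * (real 3 + M\<^sup>2)\<^sup>2) * exp (?r\<^sup>2 / 16)))"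
      using \<epsilon> M by (intro mult_left_mono poly_exp_le_exp_square) auto
    also have "\<dots> = \<epsilon> ^ 3 * (K1 * exp (?r\<^sup>2 / 16))"
      by (simp add: K1_def mult_ac)
    also have "\<dots> \<le> \<epsilon> ^ 3 * (K1 * exp (5 / 16 * ?r\<^sup>2))"
      using \<epsilon> nn by (intro mult_left_mono) auto
    finally have 1: "\<bar>(\<Sum>x\<in>UNIV. q x * e x) - main\<bar> \<le> \<epsilon> ^ 3 * (K1 * exp (5 / 16 * ?r\<^sup>2))" .
    have "CARD('d) \<ge> 1" by (simp add: Suc_leI)
    hence "\<bar>exp (?r\<^sup>2 * (1 - 1 / (sqrt (1 + \<epsilon>\<^sup>2))\<^sup>2) / 2) / sqrt (1 + \<epsilon>\<^sup>2) ^ CARD('d) - main\<bar>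
        \<le> \<epsilon> ^ 3 * (2 * (real CARD('d))\<^sup>2 * (1 + ?r) ^ 4 * exp (?r\<^sup>2 / 4))"
      unfolding main_def by (intro gauss_scale_factor_bound \<epsilon>) auto
    also have "\<dots> = \<epsilon> ^ 3 * (2 * (real CARD('d))\<^sup>2 * ((1 + ?r) ^ 4 * exp (0 * ?r)) * exp (?r\<^sup>2 / 4))"
      by simp
    also have "\<dots> \<le> \<epsilon> ^ 3 * (2 * (real CARD('d))\<^sup>2 * (exp (4 * (real 4 + 0)\<^sup>2) * exp (?r\<^sup>2 / 16)) * exp (?r\<^sup>2 / 4))"
      using \<epsilon> by (intro mult_left_mono mult_right_mono poly_exp_le_exp_square) auto
    also have "\<dots> = \<epsilon> ^ 3 * (K2 * (exp (?r\<^sup>2 / 16) * exp (?r\<^sup>2 / 4)))"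
      by (simp add: K2_def mult_ac)
    also have "exp (?r\<^sup>2 / 16) * exp (?r\<^sup>2 / 4) = exp (5 / 16 * ?r\<^sup>2)"
      by (simp flip: exp_add)
    finally have 2: "\<bar>exp (?r\<^sup>2 * (1 - 1 / (sqrt (1 + \<epsilon>\<^sup>2))\<^sup>2) / 2) / sqrt (1 + \<epsilon>\<^sup>2) ^ CARD('d) - main\<bar>
        \<le> \<epsilon> ^ 3 * (K2 * exp (5 / 16 * ?r\<^sup>2))" .
    show ?thesis
      using 1 2 unfolding ratio_diff_def e_def by (simp add: distrib_left distrib_right)
  qed
  thus ?thesis using nn by (intro exI[of _ "K1 + K2"]) auto
qed

lemma integral_ratio_diff:
  fixes F :: "real^'d::finite \<Rightarrow> real" and \<xi> :: "'b::finite \<Rightarrow> real^'d"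
  assumes F [measurable]: "F \<in> borel_measurable borel" "\<And>w. \<bar>F w\<bar> \<le> 1" and \<epsilon>: "\<epsilon> > 0"
  shows "integrable gauss_measure (\<lambda>w. ratio_diff q \<xi> \<epsilon> w * F w)"
    and "(\<Sum>x\<in>UNIV. q x * (\<integral>w. F (w + \<epsilon> *\<^sub>R \<xi> x) \<partial>gauss_measure))
      - (\<integral>w. F (sqrt (1 + \<epsilon>\<^sup>2) *\<^sub>R w) \<partial>gauss_measure) = (\<integral>w. ratio_diff q \<xi> \<epsilon> w * F w \<partial>gauss_measure)"
proof -
  define e where "e x w = exp (w \<bullet> (\<epsilon> *\<^sub>R \<xi> x) - (norm (\<epsilon> *\<^sub>R \<xi> x))\<^sup>2 / 2)" for x w
  define s where "s w = exp ((norm w)\<^sup>2 * (1 - 1 / (sqrt (1 + \<epsilon>\<^sup>2))\<^sup>2) / 2) / sqrt (1 + \<epsilon>\<^sup>2) ^ CARD('d)" for w :: "real^'d"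
  have [measurable]: "F \<in> borel_measurable gauss_measure" by simp
  have "integrable gauss_measure (e x)" for x
  proof (rule Bochner_Integration.integrable_bound)
    define y where "y = \<epsilon> *\<^sub>R \<xi> x"
    show "integrable gauss_measure (\<lambda>w::real^'d. exp ((norm y)\<^sup>2 / 2) * exp (1 / 4 * (norm w)\<^sup>2))"
      by (intro integrable_mult_right gauss_integrable_exp_norm) simp
    have "norm (e x w) \<le> exp ((norm y)\<^sup>2 / 2) * exp (1 / 4 * (norm w)\<^sup>2)" for w
    proof -
      have "w \<bullet> y \<le> norm w * norm y" by (rule norm_cauchy_schwarz)
      moreover have "norm w * norm y \<le> 1 / 4 * (norm w)\<^sup>2 + (norm y)\<^sup>2"
        using zero_le_power2[of "norm w / 2 - norm y"] by (simp add: power2_diff power_divide)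
      ultimately have "w \<bullet> y - (norm y)\<^sup>2 / 2 \<le> (norm y)\<^sup>2 / 2 + 1 / 4 * (norm w)\<^sup>2" by linarith
      thus ?thesis unfolding e_def y_def[symmetric] exp_add[symmetric] by simp
    qed
    thus "AE w in gauss_measure. norm (e x w) \<le> norm (exp ((norm y)\<^sup>2 / 2) * exp (1 / 4 * (norm w)\<^sup>2))"
      by (intro AE_I2) (simp add: abs_mult)
    show "e x \<in> borel_measurable gauss_measure"
      unfolding e_def by measurable
  qed
  hence ie: "integrable gauss_measure (\<lambda>w. e x w * F w)" for x
    by (rule integrable_mult_bounded) (use F in auto)
  have "integrable gauss_measure (\<lambda>w::real^'d. exp (((1 - 1 / (sqrt (1 + \<epsilon>\<^sup>2))\<^sup>2) / 2) * (norm w)\<^sup>2))"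
    by (rule gauss_integrable_exp_norm) (use \<epsilon> in \<open>auto simp: add_pos_nonneg\<close>)
  hence "integrable gauss_measure s"
    unfolding s_def by (intro integrable_divide) (simp add: mult.commute)
  hence int_s: "integrable gauss_measure (\<lambda>w. s w * F w)"
    by (rule integrable_mult_bounded) (use F in auto)
  have rd: "ratio_diff q \<xi> \<epsilon> w * F w = (\<Sum>x\<in>UNIV. q x * (e x w * F w)) - s w * F w" for w
    unfolding ratio_diff_def e_def s_def by (simp add: left_diff_distrib sum_distrib_right mult.assoc)
  show "integrable gauss_measure (\<lambda>w. ratio_diff q \<xi> \<epsilon> w * F w)"
    unfolding rd using ie int_s by simp
  have "(\<integral>w. F (w + \<epsilon> *\<^sub>R \<xi> x) \<partial>gauss_measure) = (\<integral>w. e x w * F w \<partial>gauss_measure)" for x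
    unfolding e_def by (rule gauss_integral_shift) fact
  moreover have "(\<integral>w. F (sqrt (1 + \<epsilon>\<^sup>2) *\<^sub>R w) \<partial>gauss_measure) = (\<integral>w. s w * F w \<partial>gauss_measure)"
    unfolding s_def by (rule gauss_integral_scale) (use \<epsilon> F in \<open>auto simp: add_pos_nonneg\<close>)
  ultimately show "(\<Sum>x\<in>UNIV. q x * (\<integral>w. F (w + \<epsilon> *\<^sub>R \<xi> x) \<partial>gauss_measure))
      - (\<integral>w. F (sqrt (1 + \<epsilon>\<^sup>2) *\<^sub>R w) \<partial>gauss_measure) = (\<integral>w. ratio_diff q \<xi> \<epsilon> w * F w \<partial>gauss_measure)"
    unfolding rd using ie int_s by (simp add: Bochner_Integration.integral_diff Bochner_Integration.integral_sum)
qed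

text \<open>Projected on a nonzero row of \<open>A\<close>, the walk has positive variance by
  isotropy, so the interval estimate applies to every hyperplane, uniformly in
  \<open>c\<close>.\<close>

lemma walk_near_boundary:
  fixes A :: "real^'d::finite^'e::finite" and \<xi> :: "'b::finite \<Rightarrow> real^'d"
  assumes iso: "isotropic_walk q \<xi>"
  shows "\<exists>C\<ge>0. \<forall>k c L. L \<ge> 0 \<longrightarrow> walk q \<xi> k (near_boundary A c L) \<le> C * (L + 1) / sqrt (real k + 1)"
proof -
  note q_nonneg = isotropic_walkD(1)[OF iso] and q_sum = isotropic_walkD(2)[OF iso]
    and mean = isotropic_walkD(3)[OF iso] and cov = isotropic_walkD(4)[OF iso]
  have "\<exists>C\<ge>0. \<forall>k z L. L \<ge> 0 \<longrightarrow> walk q (\<lambda>x. A $ t \<bullet> \<xi> x) k (\<lambda>u. of_bool (\<bar>u - z\<bar> \<le> L)) \<le> C * (L + 1) / sqrt (real k + 1)"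
    if "A $ t \<noteq> 0" for t
    using that by (intro walk_interval q_nonneg q_sum) (simp_all add: mean cov)
  then obtain C where C: "\<And>t. A $ t \<noteq> 0 \<Longrightarrow> C t \<ge> 0"
    "\<And>t k z L. A $ t \<noteq> 0 \<Longrightarrow> L \<ge> 0 \<Longrightarrow>
       walk q (\<lambda>x. A $ t \<bullet> \<xi> x) k (\<lambda>u. of_bool (\<bar>u - z\<bar> \<le> L)) \<le> C t * (L + 1) / sqrt (real k + 1)"
    by metis
  define K where "K = (\<Sum>t | A $ t \<noteq> 0. C t * (norm (A $ t) + 1))"
  have "walk q \<xi> k (near_boundary A c L) \<le> K * (L + 1) / sqrt (real k + 1)" if L: "L \<ge> 0" for k c L
  proof -
    have "walk q \<xi> k (near_boundary A c L) =
      (\<Sum>t | A $ t \<noteq> 0. walk q \<xi> k (\<lambda>u. of_bool (\<bar>A $ t \<bullet> u - c $ t\<bar> \<le> norm (A $ t) * L)))"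
      unfolding near_boundary_def[abs_def] by (rule walk_sum)
    also have "\<dots> \<le> (\<Sum>t | A $ t \<noteq> 0. C t * (norm (A $ t) + 1) * ((L + 1) / sqrt (real k + 1)))"
    proof (intro sum_mono)
      fix t assume t: "t \<in> {t. A $ t \<noteq> 0}"
      have "walk q \<xi> k (\<lambda>u. of_bool (\<bar>A $ t \<bullet> u - c $ t\<bar> \<le> norm (A $ t) * L)) =
            walk q (\<lambda>x. A $ t \<bullet> \<xi> x) k (\<lambda>u. of_bool (\<bar>u - c $ t\<bar> \<le> norm (A $ t) * L))"
        by (rule walk_linear_image[where h = "\<lambda>u. of_bool (\<bar>u - c $ t\<bar> \<le> norm (A $ t) * L)"])
           (intro bounded_linear.linear bounded_linear_inner_right)
      also have "\<dots> \<le> C t * (norm (A $ t) * L + 1) / sqrt (real k + 1)"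
        using t L by (intro C) auto
      also have "\<dots> \<le> C t * ((norm (A $ t) + 1) * (L + 1)) / sqrt (real k + 1)"
        using t L C(1)[of t] by (intro divide_right_mono mult_left_mono) (auto simp: algebra_simps)
      finally show "walk q \<xi> k (\<lambda>u. of_bool (\<bar>A $ t \<bullet> u - c $ t\<bar> \<le> norm (A $ t) * L)) \<le>
        C t * (norm (A $ t) + 1) * ((L + 1) / sqrt (real k + 1))" by (simp add: mult.assoc)
    qed
    also have "\<dots> = K * (L + 1) / sqrt (real k + 1)"
      by (simp add: K_def sum_distrib_right sum_divide_distrib)
    finally show ?thesis .
  qed
  moreover have "K \<ge> 0" unfolding K_def using C(1) by (intro sum_nonneg) auto
  ultimately show ?thesis by blast
qed

lemma integrable_exp_near_boundary:
  fixes A :: "real^'d::finite^'e::finite"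
  assumes "a < 1 / 2"
  shows "integrable gauss_measure (\<lambda>w::real^'d. exp (a * (norm w)\<^sup>2) * near_boundary A c (s * norm w) u)"
  unfolding near_boundary_def sum_distrib_left
proof (intro Bochner_Integration.integrable_sum integrable_mult_bounded gauss_integrable_exp_norm assms)
  fix t
  show "(\<lambda>w. of_bool (\<bar>A $ t \<bullet> u - c $ t\<bar> \<le> norm (A $ t) * (s * norm w)) :: real) \<in> borel_measurable gauss_measure"
    unfolding of_bool_def by measurable
qed auto

definition smoothed :: "real^'d::finite^'e::finite \<Rightarrow> real^'e \<Rightarrow> nat \<Rightarrow> real^'d \<Rightarrow> real" where
  "smoothed A c m u = (\<integral>w. of_bool (c \<le> A *v (u + sqrt (real m) *\<^sub>R w)) \<partial>(gauss_measure :: (real^'d) measure))"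

definition step_diff :: "('b::finite \<Rightarrow> real) \<Rightarrow> ('b \<Rightarrow> real^'d::finite) \<Rightarrow> real^'d^'e::finite \<Rightarrow> real^'e \<Rightarrow> nat \<Rightarrow> real^'d \<Rightarrow> real" where
  "step_diff q \<xi> A c m u = (\<Sum>x\<in>UNIV. q x * smoothed A c m (u + \<xi> x)) - smoothed A c (Suc m) u"

lemma orthant_measurable [measurable]:
  fixes A :: "real^'d::finite^'e::finite"
  assumes [measurable]: "g \<in> borel_measurable M"
  shows "(\<lambda>w. of_bool (c \<le> A *v g w) :: real) \<in> borel_measurable M"
  using measurable_compose[OF assms borel_measurable_orthant] .

text \<open>In units of sqrt m a single step has size \<epsilon> = 1 / sqrt m, and \<epsilon>^3 is
  the factor in front. The dependence on \<open>u\<close> is kept under the integral, to be averaged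
  over the walk later.\<close>

lemma step_diff_bound:
  fixes A :: "real^'d::finite^'e::finite" and \<xi> :: "'b::finite \<Rightarrow> real^'d"
  assumes iso: "isotropic_walk q \<xi>"
  shows "\<exists>K\<ge>0. \<forall>c m u. m > 0 \<longrightarrow> \<bar>step_diff q \<xi> A c m u\<bar> \<le>
    (\<integral>w. K / (real m * sqrt (real m)) * (exp (5 / 16 * (norm w)\<^sup>2) * near_boundary A c (sqrt (real m) * norm w) u) \<partial>(gauss_measure :: (real^'d) measure))"
proof -
  note q_nonneg = isotropic_walkD(1)[OF iso] and q_sum = isotropic_walkD(2)[OF iso]
  obtain K where K: "K \<ge> 0"
    "\<And>\<epsilon> w. 0 < \<epsilon> \<Longrightarrow> \<epsilon> \<le> 1 \<Longrightarrow> \<bar>ratio_diff q \<xi> \<epsilon> w\<bar> \<le> \<epsilon> ^ 3 * (K * exp (5 / 16 * (norm w)\<^sup>2))"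
    using ratio_diff_bound[OF iso] by blast
  have "\<bar>step_diff q \<xi> A c m u\<bar> \<le>
    (\<integral>w. K / (real m * sqrt (real m)) * (exp (5 / 16 * (norm w)\<^sup>2) * near_boundary A c (sqrt (real m) * norm w) u) \<partial>(gauss_measure :: (real^'d) measure))"
    if m: "m > 0" for c m u
  proof -
    define \<epsilon> where "\<epsilon> = 1 / sqrt (real m)"
    have \<epsilon>: "\<epsilon> > 0" "\<epsilon> \<le> 1" using m by (auto simp: \<epsilon>_def)
    have \<epsilon>3: "\<epsilon> ^ 3 = 1 / (real m * sqrt (real m))"
      by (simp add: \<epsilon>_def eval_nat_numeral)
    define F where "F w = (of_bool (c \<le> A *v (u + sqrt (real m) *\<^sub>R w)) :: real)" for w :: "real^'d"
    define f0 where "f0 = (of_bool (c \<le> A *v u) :: real)"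
    have F [measurable]: "F \<in> borel_measurable borel"
      unfolding F_def by measurable
    have F1: "\<bar>F w\<bar> \<le> 1" for w by (simp add: F_def)
    have shift: "F (w + \<epsilon> *\<^sub>R \<xi> x) = of_bool (c \<le> A *v (u + \<xi> x + sqrt (real m) *\<^sub>R w))" for w x
      using m by (simp add: F_def \<epsilon>_def algebra_simps)
    have "sqrt (real m) * sqrt (1 + \<epsilon>\<^sup>2) = sqrt (real (Suc m))"
      using m by (simp add: \<epsilon>_def power_divide distrib_left flip: real_sqrt_mult)
    hence scale: "F (sqrt (1 + \<epsilon>\<^sup>2) *\<^sub>R w) = of_bool (c \<le> A *v (u + sqrt (real (Suc m)) *\<^sub>R w))" for w
      by (simp add: F_def)
    have sd: "step_diff q \<xi> A c m u = (\<integral>w. ratio_diff q \<xi> \<epsilon> w * F w \<partial>(gauss_measure :: (real^'d) measure))"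
      using integral_ratio_diff(2)[OF F F1 \<epsilon>(1), of q \<xi>]
      by (simp only: step_diff_def smoothed_def shift scale)
    \<comment> \<open>Both ratios have mass 1, so the value \<open>f0\<close> at the unperturbed
      point can be subtracted. The difference \<open>F w - f0\<close> vanishes unless
      \<open>u\<close> is close to a hyperplane.\<close>
    have "(\<integral>w. ratio_diff q \<xi> \<epsilon> w * 1 \<partial>(gauss_measure :: (real^'d) measure)) = 0"
      using integral_ratio_diff(2)[of "\<lambda>_. 1" \<epsilon> q \<xi>] \<epsilon> by (simp add: q_sum)
    moreover have ird: "integrable gauss_measure (\<lambda>w. ratio_diff q \<xi> \<epsilon> w * 1)"
      by (rule integral_ratio_diff(1)) (use \<epsilon> in auto)
    moreover have irF: "integrable gauss_measure (\<lambda>w. ratio_diff q \<xi> \<epsilon> w * F w)"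
      by (rule integral_ratio_diff(1)) (use \<epsilon> F1 in auto)
    ultimately have "step_diff q \<xi> A c m u = (\<integral>w. ratio_diff q \<xi> \<epsilon> w * (F w - f0) \<partial>(gauss_measure :: (real^'d) measure))"
      by (simp add: sd right_diff_distrib)
    also have "\<bar>\<dots>\<bar> \<le> (\<integral>w. \<bar>ratio_diff q \<xi> \<epsilon> w * (F w - f0)\<bar> \<partial>(gauss_measure :: (real^'d) measure))"
      using integral_norm_bound[of gauss_measure "\<lambda>w. ratio_diff q \<xi> \<epsilon> w * (F w - f0)"] by simp
    also have "\<dots> \<le> (\<integral>w. K / (real m * sqrt (real m)) * (exp (5 / 16 * (norm w)\<^sup>2) * near_boundary A c (sqrt (real m) * norm w) u) \<partial>(gauss_measure :: (real^'d) measure))"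
    proof (rule integral_mono)
      have "integrable gauss_measure (\<lambda>w. ratio_diff q \<xi> \<epsilon> w * (F w - f0))"
        using irF ird by (simp add: right_diff_distrib)
      thus "integrable gauss_measure (\<lambda>w. \<bar>ratio_diff q \<xi> \<epsilon> w * (F w - f0)\<bar>)"
        by (rule integrable_abs)
      show "integrable gauss_measure (\<lambda>w::real^'d. K / (real m * sqrt (real m)) *
          (exp (5 / 16 * (norm w)\<^sup>2) * near_boundary A c (sqrt (real m) * norm w) u))"
        by (intro integrable_mult_right integrable_exp_near_boundary) simp
      fix w :: "real^'d"
      have "\<bar>F w - f0\<bar> \<le> near_boundary A c (sqrt (real m) * norm w) u"
        using orthant_diff_le_near_boundary[of c A u "sqrt (real m) *\<^sub>R w"]
        by (simp add: F_def f0_def)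
      hence "\<bar>ratio_diff q \<xi> \<epsilon> w * (F w - f0)\<bar> \<le>
          (\<epsilon> ^ 3 * (K * exp (5 / 16 * (norm w)\<^sup>2))) * near_boundary A c (sqrt (real m) * norm w) u"
        unfolding abs_mult by (intro mult_mono K \<epsilon>) (use \<epsilon> K in auto)
      thus "\<bar>ratio_diff q \<xi> \<epsilon> w * (F w - f0)\<bar> \<le> K / (real m * sqrt (real m)) *
          (exp (5 / 16 * (norm w)\<^sup>2) * near_boundary A c (sqrt (real m) * norm w) u)"
        by (simp add: \<epsilon>3)
    qed
    finally show ?thesis .
  qed
  thus ?thesis using K(1) by blast
qed

text \<open>Without Gaussian smoothing both sides are simply compared with the indicator at
  \<open>u\<close>. The weight exp (5 / 16 ...) \<ge> 1 and the factor 1 bring the integral into the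
  shape of \<open>walk_integral_near_boundary\<close>.\<close>

lemma step_diff_bound_0:
  fixes A :: "real^'d::finite^'e::finite" and \<xi> :: "'b::finite \<Rightarrow> real^'d"
  assumes iso: "isotropic_walk q \<xi>"
  shows "\<bar>step_diff q \<xi> A c 0 u\<bar> \<le> (\<Sum>x\<in>UNIV. q x * near_boundary A c (norm (\<xi> x)) u)
    + (\<integral>w. exp (5 / 16 * (norm w)\<^sup>2) * near_boundary A c (1 * norm w) u \<partial>(gauss_measure :: (real^'d) measure))"
proof -
  note q_nonneg = isotropic_walkD(1)[OF iso] and q_sum = isotropic_walkD(2)[OF iso]
  define f where "f u = (of_bool (c \<le> A *v u) :: real)" for u
  have f: "integrable gauss_measure (\<lambda>w. f (u + w))"
  proof -
    have "(\<lambda>w. f (u + w)) \<in> borel_measurable gauss_measure" unfolding f_def by measurable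
    hence "integrable gauss_measure (\<lambda>w. 1 * f (u + w))"
      by (intro integrable_mult_bounded) (auto simp: f_def)
    thus ?thesis by simp
  qed
  have s0: "smoothed A c 0 v = f v" for v
    by (simp add: smoothed_def f_def)
  have "step_diff q \<xi> A c 0 u = (\<Sum>x\<in>UNIV. q x * f (u + \<xi> x)) - (\<integral>w. f (u + w) \<partial>(gauss_measure :: (real^'d) measure))"
    by (simp add: step_diff_def s0) (simp add: smoothed_def f_def)
  also have "\<dots> = (\<Sum>x\<in>UNIV. q x * (f (u + \<xi> x) - f u)) - (\<integral>w. f (u + w) - f u \<partial>(gauss_measure :: (real^'d) measure))"
    using f by (simp add: right_diff_distrib sum_subtractf q_sum flip: sum_distrib_right)
  finally have eq: "step_diff q \<xi> A c 0 u = \<dots>" .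
  have "\<bar>\<Sum>x\<in>UNIV. q x * (f (u + \<xi> x) - f u)\<bar> \<le> (\<Sum>x\<in>UNIV. \<bar>q x * (f (u + \<xi> x) - f u)\<bar>)"
    by (rule sum_abs)
  also have "\<dots> \<le> (\<Sum>x\<in>UNIV. q x * near_boundary A c (norm (\<xi> x)) u)"
    unfolding abs_mult abs_of_nonneg[OF q_nonneg] f_def
    by (intro sum_mono mult_left_mono orthant_diff_le_near_boundary q_nonneg)
  finally have 1: "\<bar>\<Sum>x\<in>UNIV. q x * (f (u + \<xi> x) - f u)\<bar> \<le> (\<Sum>x\<in>UNIV. q x * near_boundary A c (norm (\<xi> x)) u)" .
  have "\<bar>\<integral>w. f (u + w) - f u \<partial>(gauss_measure :: (real^'d) measure)\<bar> \<le> (\<integral>w. \<bar>f (u + w) - f u\<bar> \<partial>(gauss_measure :: (real^'d) measure))"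
    using integral_norm_bound[of gauss_measure "\<lambda>w. f (u + w) - f u"] by simp
  also have "\<dots> \<le> (\<integral>w. exp (5 / 16 * (norm w)\<^sup>2) * near_boundary A c (1 * norm w) u \<partial>(gauss_measure :: (real^'d) measure))"
  proof (rule integral_mono)
    show "integrable gauss_measure (\<lambda>w. \<bar>f (u + w) - f u\<bar>)" using f by simp
    show "integrable gauss_measure (\<lambda>w::real^'d. exp (5 / 16 * (norm w)\<^sup>2) * near_boundary A c (1 * norm w) u)"
      by (rule integrable_exp_near_boundary) simp
    fix w :: "real^'d"
    have "\<bar>f (u + w) - f u\<bar> \<le> 1 * near_boundary A c (1 * norm w) u"
      using orthant_diff_le_near_boundary[of c A u w] by (simp add: f_def)
    also have "\<dots> \<le> exp (5 / 16 * (norm w)\<^sup>2) * near_boundary A c (1 * norm w) u"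
      by (intro mult_right_mono near_boundary_nonneg) simp
    finally show "\<bar>f (u + w) - f u\<bar> \<le> exp (5 / 16 * (norm w)\<^sup>2) * near_boundary A c (1 * norm w) u" .
  qed
  finally show ?thesis using 1 unfolding eq by linarith
qed

text \<open>For fixed \<open>w\<close> the walk estimate grows only linearly in s * norm w, which
  the Gaussian measure integrates against the weight; s \<ge> 1 lets \<open>s\<close> be factored
  out of s * norm w + 1.\<close>

lemma walk_integral_near_boundary:
  fixes A :: "real^'d::finite^'e::finite" and \<xi> :: "'b::finite \<Rightarrow> real^'d"
  assumes iso: "isotropic_walk q \<xi>"
  shows "\<exists>G\<ge>0. \<forall>c k s. s \<ge> 1 \<longrightarrow>
    walk q \<xi> k (\<lambda>u. \<integral>w. exp (5 / 16 * (norm w)\<^sup>2) * near_boundary A c (s * norm w) u \<partial>(gauss_measure :: (real^'d) measure))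
     \<le> G * s / sqrt (real k + 1)"
proof -
  obtain C where C: "C \<ge> 0"
    "\<And>k c L. L \<ge> 0 \<Longrightarrow> walk q \<xi> k (near_boundary A c L) \<le> C * (L + 1) / sqrt (real k + 1)"
    using walk_near_boundary[OF iso, of A] by blast
  define g where "g w = exp (5 / 16 * (norm w)\<^sup>2) * (norm w + 1)" for w :: "real^'d"
  have ig: "integrable gauss_measure g"
  proof (rule Bochner_Integration.integrable_bound)
    \<comment> \<open>3 / 8 = 5 / 16 + 1 / 16, where 1 / 16 and the constant exp 4 pay for the
      factor norm w + 1.\<close>
    show "integrable gauss_measure (\<lambda>w::real^'d. exp 4 * exp (3 / 8 * (norm w)\<^sup>2))"
      by (intro integrable_mult_right gauss_integrable_exp_norm) simp
    show "g \<in> borel_measurable gauss_measure" unfolding g_def by measurable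
    have "norm (g w) \<le> exp 4 * exp (3 / 8 * (norm w)\<^sup>2)" for w
    proof -
      have "norm w + 1 \<le> exp 4 * exp ((norm w)\<^sup>2 / 16)"
        using poly_exp_le_exp_square[of "norm w" 1 0] by simp
      hence "g w \<le> exp (5 / 16 * (norm w)\<^sup>2) * (exp 4 * exp ((norm w)\<^sup>2 / 16))"
        unfolding g_def by (intro mult_left_mono) auto
      also have "\<dots> = exp 4 * exp (3 / 8 * (norm w)\<^sup>2)"
        by (simp flip: exp_add)
      finally show ?thesis by (simp add: g_def)
    qed
    thus "AE w in gauss_measure. norm (g w) \<le> norm (exp 4 * exp (3 / 8 * (norm w)\<^sup>2))"
      by (intro AE_I2) (simp add: abs_mult)
  qed
  define G where "G = C * (\<integral>w. g w \<partial>(gauss_measure :: (real^'d) measure))"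
  have "walk q \<xi> k (\<lambda>u. \<integral>w. exp (5 / 16 * (norm w)\<^sup>2) * near_boundary A c (s * norm w) u \<partial>(gauss_measure :: (real^'d) measure))
     \<le> G * s / sqrt (real k + 1)" if s: "s \<ge> 1" for c k s
  proof -
    let ?h = "\<lambda>(w::real^'d) u. exp (5 / 16 * (norm w)\<^sup>2) * near_boundary A c (s * norm w) u"
    have i: "integrable gauss_measure (\<lambda>w. ?h w u)" for u
      by (rule integrable_exp_near_boundary) simp
    have "walk q \<xi> k (\<lambda>u. \<integral>w. ?h w u \<partial>(gauss_measure :: (real^'d) measure)) = (\<integral>w. walk q \<xi> k (?h w) \<partial>(gauss_measure :: (real^'d) measure))"
      by (rule walk_integral(2)[OF i])
    also have "\<dots> \<le> (\<integral>w. (C * s / sqrt (real k + 1)) * g w \<partial>(gauss_measure :: (real^'d) measure))"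
    proof (rule integral_mono)
      show "integrable gauss_measure (\<lambda>w. walk q \<xi> k (?h w))"
        by (rule walk_integral(1)[OF i])
      show "integrable gauss_measure (\<lambda>w. (C * s / sqrt (real k + 1)) * g w)"
        using ig by simp
      fix w :: "real^'d"
      have "walk q \<xi> k (?h w) = exp (5 / 16 * (norm w)\<^sup>2) * walk q \<xi> k (near_boundary A c (s * norm w))"
        by (rule walk_cmult)
      also have "\<dots> \<le> exp (5 / 16 * (norm w)\<^sup>2) * (C * (s * norm w + 1) / sqrt (real k + 1))"
        using s by (intro mult_left_mono C) auto
      also have "\<dots> \<le> exp (5 / 16 * (norm w)\<^sup>2) * (C * (s * (norm w + 1)) / sqrt (real k + 1))"
        using s C by (intro mult_left_mono divide_right_mono) (auto simp: algebra_simps)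
      also have "\<dots> = (C * s / sqrt (real k + 1)) * g w"
        by (simp add: g_def)
      finally show "walk q \<xi> k (?h w) \<le> (C * s / sqrt (real k + 1)) * g w" .
    qed
    also have "\<dots> = G * s / sqrt (real k + 1)"
      by (simp add: G_def mult_ac)
    finally show ?thesis .
  qed
  moreover have "G \<ge> 0"
    unfolding G_def by (intro mult_nonneg_nonneg C Bochner_Integration.integral_nonneg) (simp add: g_def)
  ultimately show ?thesis by blast
qed

text \<open>\<open>A\<close> may be singular or rectangular: the exchange happens before
  \<open>A\<close> is applied, so a degenerate image law causes no difficulty.\<close>

theorem berry_esseen_orthant:
  fixes A :: "real^'d::finite^'e::finite" and \<xi> :: "'b::finite \<Rightarrow> real^'d"
  assumes iso: "isotropic_walk q \<xi>"
  shows "\<exists>C. \<forall>n>0. \<forall>z. \<bar>walk q \<xi> n (\<lambda>u. of_bool (sqrt (real n) *\<^sub>R z \<le> A *v u))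
      - (\<integral>w. of_bool (z \<le> A *v w) \<partial>(gauss_measure :: (real^'d) measure))\<bar> \<le> C * (1 + ln (real n)) / sqrt (real n)"
proof -
  note q_nonneg = isotropic_walkD(1)[OF iso] and q_sum = isotropic_walkD(2)[OF iso]
  obtain K where K: "K \<ge> 0" "\<And>c m u. m > 0 \<Longrightarrow> \<bar>step_diff q \<xi> A c m u\<bar> \<le>
    (\<integral>w. K / (real m * sqrt (real m)) * (exp (5 / 16 * (norm w)\<^sup>2) * near_boundary A c (sqrt (real m) * norm w) u) \<partial>(gauss_measure :: (real^'d) measure))"
    using step_diff_bound[OF iso] by blast
  obtain G where G: "G \<ge> 0" "\<And>c k s. s \<ge> 1 \<Longrightarrow>
    walk q \<xi> k (\<lambda>u. \<integral>w. exp (5 / 16 * (norm w)\<^sup>2) * near_boundary A c (s * norm w) u \<partial>(gauss_measure :: (real^'d) measure))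
     \<le> G * s / sqrt (real k + 1)"
    using walk_integral_near_boundary[OF iso] by blast
  obtain C where C: "C \<ge> 0"
    "\<And>k c L. L \<ge> 0 \<Longrightarrow> walk q \<xi> k (near_boundary A c L) \<le> C * (L + 1) / sqrt (real k + 1)"
    using walk_near_boundary[OF iso, of A] by blast
  obtain M where M: "M \<ge> 1" "\<And>x. norm (\<xi> x) \<le> M" using norm_step_bound by blast
  have step_pos: "\<bar>walk q \<xi> k (step_diff q \<xi> A c m)\<bar> \<le> K * G * (1 / (real m * sqrt (real k + 1)))" if m: "m > 0" for c k m
  proof -
    have "\<bar>walk q \<xi> k (step_diff q \<xi> A c m)\<bar> \<le> walk q \<xi> k (\<lambda>u.
       K / (real m * sqrt (real m)) * (\<integral>w. exp (5 / 16 * (norm w)\<^sup>2) * near_boundary A c (sqrt (real m) * norm w) u \<partial>(gauss_measure :: (real^'d) measure)))"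
      using K(2)[OF m, of c] unfolding integral_mult_right_zero by (intro walk_abs_le q_nonneg)
    also have "\<dots> \<le> K / (real m * sqrt (real m)) * (G * sqrt (real m) / sqrt (real k + 1))"
      unfolding walk_cmult using K(1) m by (intro mult_left_mono G) auto
    also have "\<dots> = K * G * (1 / (real m * sqrt (real k + 1)))"
      using m by simp
    finally show ?thesis .
  qed
  have step_0: "\<bar>walk q \<xi> k (step_diff q \<xi> A c 0)\<bar> \<le> (C * (M + 1) + G) / sqrt (real k + 1)" for c k
  proof -
    have "\<bar>walk q \<xi> k (step_diff q \<xi> A c 0)\<bar> \<le> walk q \<xi> k (\<lambda>u. (\<Sum>x\<in>UNIV. q x * near_boundary A c (norm (\<xi> x)) u)
      + (\<integral>w. exp (5 / 16 * (norm w)\<^sup>2) * near_boundary A c (1 * norm w) u \<partial>(gauss_measure :: (real^'d) measure)))"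
      by (intro walk_abs_le q_nonneg step_diff_bound_0 iso)
    also have "\<dots> = (\<Sum>x\<in>UNIV. q x * walk q \<xi> k (near_boundary A c (norm (\<xi> x)))) +
        walk q \<xi> k (\<lambda>u. \<integral>w. exp (5 / 16 * (norm w)\<^sup>2) * near_boundary A c (1 * norm w) u \<partial>(gauss_measure :: (real^'d) measure))"
      unfolding walk_add walk_sum walk_cmult ..
    also have "\<dots> \<le> (\<Sum>x\<in>UNIV. q x * (C * (M + 1) / sqrt (real k + 1))) + G * 1 / sqrt (real k + 1)"
    proof (intro add_mono sum_mono mult_left_mono q_nonneg)
      fix x
      have "walk q \<xi> k (near_boundary A c (norm (\<xi> x))) \<le> C * (norm (\<xi> x) + 1) / sqrt (real k + 1)"
        by (intro C) simp
      also have "\<dots> \<le> C * (M + 1) / sqrt (real k + 1)"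
        using M(2)[of x] C(1) by (intro divide_right_mono mult_left_mono) auto
      finally show "walk q \<xi> k (near_boundary A c (norm (\<xi> x))) \<le> C * (M + 1) / sqrt (real k + 1)" .
    qed (rule G(2)[OF order_refl])
    also have "\<dots> = (C * (M + 1) + G) / sqrt (real k + 1)"
      by (simp only: sum_distrib_right[symmetric] q_sum) (simp add: add_divide_distrib)
    finally show ?thesis .
  qed
  have "\<bar>walk q \<xi> n (\<lambda>u. of_bool (sqrt (real n) *\<^sub>R z \<le> A *v u))
      - (\<integral>w. of_bool (z \<le> A *v w) \<partial>(gauss_measure :: (real^'d) measure))\<bar> \<le> (C * (M + 1) + G + 2 * (K * G)) * (1 + ln (real n)) / sqrt (real n)"
    if n: "n > 0" for n z
  proof -
    define c where "c = sqrt (real n) *\<^sub>R z"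
    \<comment> \<open>\<open>k\<close> walk steps and \<open>n - k\<close> Gaussian ones.
      Neighbouring hybrids have n - 1 - k Gaussian steps in common, whence the index in
      \<open>diff\<close>.\<close>
    define a where "a k = walk q \<xi> k (smoothed A c (n - k))" for k
    have an: "a n = walk q \<xi> n (\<lambda>u. of_bool (c \<le> A *v u))"
      by (simp add: a_def smoothed_def[abs_def])
    have "(c \<le> A *v (sqrt (real n) *\<^sub>R w)) = (z \<le> A *v w)" for w
      using n by (simp add: c_def less_eq_vec_def matrix_vector_mult_scaleR)
    hence a0: "a 0 = (\<integral>w. of_bool (z \<le> A *v w) \<partial>(gauss_measure :: (real^'d) measure))"
      by (simp add: a_def smoothed_def)
    have diff: "a (Suc k) - a k = walk q \<xi> k (step_diff q \<xi> A c (n - 1 - k))" if "k < n" for k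
      using that by (simp add: a_def walk_Suc step_diff_def[abs_def] walk_diff Suc_diff_Suc)
    have "\<bar>a n - a 0\<bar> = \<bar>\<Sum>k<n. walk q \<xi> k (step_diff q \<xi> A c (n - 1 - k))\<bar>"
      by (simp add: diff flip: sum_lessThan_telescope)
    also have "\<dots> \<le> (\<Sum>k<n. \<bar>walk q \<xi> k (step_diff q \<xi> A c (n - 1 - k))\<bar>)"
      by (rule sum_abs)
    \<comment> \<open>The last summand is the exchange with no Gaussian step left.\<close>
    also have "\<dots> = (\<Sum>k<n-1. \<bar>walk q \<xi> k (step_diff q \<xi> A c (n - 1 - k))\<bar>) + \<bar>walk q \<xi> (n - 1) (step_diff q \<xi> A c 0)\<bar>"
      using n by (cases n) auto
    also have "\<dots> \<le> (\<Sum>k<n-1. K * G * (1 / (real (n - 1 - k) * sqrt (real k + 1)))) + (C * (M + 1) + G) / sqrt (real (n - 1) + 1)"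
      by (intro add_mono sum_mono step_pos step_0) auto
    also have "(\<Sum>k<n-1. K * G * (1 / (real (n - 1 - k) * sqrt (real k + 1)))) =
        K * G * (\<Sum>k<n-1. 1 / (real (n - 1 - k) * sqrt (real k + 1)))"
      by (rule sum_distrib_left[symmetric])
    also have "\<dots> \<le> K * G * (2 * (1 + ln (real n)) / sqrt (real n))"
      using K G n by (intro mult_left_mono sum_inverse_mult_sqrt_le) auto
    also have "(C * (M + 1) + G) / sqrt (real (n - 1) + 1) = (C * (M + 1) + G) * 1 / sqrt (real n)"
      using n by (simp add: of_nat_diff)
    also have "\<dots> \<le> (C * (M + 1) + G) * (1 + ln (real n)) / sqrt (real n)"
      using n C G M by (intro divide_right_mono mult_left_mono) auto
    finally have "\<bar>a n - a 0\<bar> \<le> K * G * (2 * (1 + ln (real n)) / sqrt (real n)) + (C * (M + 1) + G) * (1 + ln (real n)) / sqrt (real n)"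
      by simp
    also have "\<dots> = (C * (M + 1) + G + 2 * (K * G)) * (1 + ln (real n)) / sqrt (real n)"
      by (simp add: algebra_simps add_divide_distrib)
    finally show ?thesis unfolding an a0 c_def .
  qed
  thus ?thesis by blast
qed

section \<open>Factorization of the covariance and reduction to isotropic steps\<close>

lemma gram_matrix_factorization:
  fixes b :: "'a::finite \<Rightarrow> real^'d::finite"
  shows "\<exists>A :: real^'d^'d. A ** transpose A = (\<Sum>x\<in>UNIV. outer (b x))"
proof -
  \<comment> \<open>The matrix is the Gram matrix of the vectors \<open>\<beta> i\<close>. They span
    at most \<open>CARD('d)\<close> dimensions, so an isometry moves them into
    \<open>real^'d\<close>, where they become the rows of \<open>A\<close>.\<close>
  define \<beta> :: "'d \<Rightarrow> real^'a" where "\<beta> i = (\<chi> x. b x $ i)" for i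
  define S where "S = span (range \<beta>)"
  have "dim S \<le> card (range \<beta>)" unfolding S_def dim_span by (rule dim_le_card') simp
  also have "\<dots> \<le> CARD('d)" by (rule card_image_le) simp
  finally have "dim S \<le> dim (UNIV :: (real^'d) set)" by simp
  then obtain f :: "real^'a \<Rightarrow> real^'d" where f: "linear f" "\<And>x. x \<in> S \<Longrightarrow> norm (f x) = norm x"
    using isometry_subset_subspace[of S "UNIV :: (real^'d) set"] unfolding S_def by auto
  have \<beta>: "\<beta> i \<in> S" for i unfolding S_def by (intro span_base) auto
  have inner: "f (\<beta> i) \<bullet> f (\<beta> j) = \<beta> i \<bullet> \<beta> j" for i j
  proof -
    have "\<beta> i + \<beta> j \<in> S" using \<beta> unfolding S_def by (intro span_add) auto
    hence "norm (f (\<beta> i) + f (\<beta> j)) = norm (\<beta> i + \<beta> j)"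
      using f by (metis linear_add)
    thus ?thesis by (simp add: dot_norm f(2) \<beta>)
  qed
  have "((\<chi> i. f (\<beta> i)) ** transpose (\<chi> i. f (\<beta> i))) = (\<Sum>x\<in>UNIV. outer (b x))"
    unfolding vec_eq_iff
  proof (intro allI)
    fix i j
    have "((\<chi> i. f (\<beta> i)) ** transpose (\<chi> i. f (\<beta> i))) $ i $ j = f (\<beta> i) \<bullet> f (\<beta> j)"
      by (simp add: matrix_matrix_mult_def transpose_def inner_vec_def)
    also have "\<dots> = (\<Sum>x\<in>UNIV. outer (b x)) $ i $ j"
      unfolding inner by (simp add: \<beta>_def inner_vec_def outer_def)
    finally show "((\<chi> i. f (\<beta> i)) ** transpose (\<chi> i. f (\<beta> i))) $ i $ j = (\<Sum>x\<in>UNIV. outer (b x)) $ i $ j" .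
  qed
  thus ?thesis by blast
qed

text \<open>Guarantees that the \<open>SOME\<close> in \<open>gauss_upper_prob\<close> selects a
  genuine factor.\<close>

lemma covariance_factorization:
  fixes Y :: "'a::finite \<Rightarrow> real^'d::finite"
  assumes "\<And>x. p x \<ge> 0"
  shows "\<exists>A :: real^'d^'d. A ** transpose A = (\<Sum>x\<in>UNIV. p x *\<^sub>R outer (Y x))"
proof -
  have "outer (sqrt (p x) *\<^sub>R Y x) = p x *\<^sub>R outer (Y x)" for x
    using assms[of x] by (simp add: outer_def vec_eq_iff)
  thus ?thesis using gram_matrix_factorization[of "\<lambda>x. sqrt (p x) *\<^sub>R Y x"] by simp
qed

lemma covariance_quadratic_form:
  fixes Y :: "'a::finite \<Rightarrow> real^'d::finite" and A :: "real^'d^'d"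
  assumes "A ** transpose A = (\<Sum>x\<in>UNIV. p x *\<^sub>R outer (Y x))"
  shows "(\<Sum>x\<in>UNIV. p x * (c \<bullet> Y x)\<^sup>2) = (norm (c v* A))\<^sup>2"
proof -
  have "(\<Sum>x\<in>UNIV. p x *\<^sub>R outer (Y x)) *v c = (\<Sum>x\<in>UNIV. (p x * (c \<bullet> Y x)) *\<^sub>R Y x)"
    unfolding vec_eq_iff
  proof
    fix i
    have "((\<Sum>x\<in>UNIV. p x *\<^sub>R outer (Y x)) *v c) $ i = (\<Sum>j\<in>UNIV. \<Sum>x\<in>UNIV. p x * (Y x $ i * Y x $ j) * c $ j)"
      by (simp add: matrix_vector_mult_def outer_def sum_distrib_right)
    also have "\<dots> = (\<Sum>x\<in>UNIV. \<Sum>j\<in>UNIV. p x * (Y x $ i * Y x $ j) * c $ j)"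
      by (rule sum.swap)
    also have "\<dots> = (\<Sum>x\<in>UNIV. (p x * (c \<bullet> Y x)) *\<^sub>R Y x) $ i"
      by (simp add: inner_vec_def sum_distrib_left sum_distrib_right mult_ac)
    finally show "((\<Sum>x\<in>UNIV. p x *\<^sub>R outer (Y x)) *v c) $ i = (\<Sum>x\<in>UNIV. (p x * (c \<bullet> Y x)) *\<^sub>R Y x) $ i" .
  qed
  hence "c \<bullet> ((A ** transpose A) *v c) = (\<Sum>x\<in>UNIV. p x * (c \<bullet> Y x)\<^sup>2)"
    by (simp add: assms inner_sum_right power2_eq_square mult_ac)
  moreover have "(A ** transpose A) *v c = A *v (c v* A)"
    by (simp add: matrix_vector_mul_assoc[symmetric])
  ultimately show ?thesis
    by (simp add: power2_norm_eq_inner dot_lmul_matrix)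
qed

text \<open>A direction orthogonal to the range of \<open>A\<close> has zero variance, so a step of
  positive weight has no component in it.\<close>

lemma step_in_range:
  fixes Y :: "'a::finite \<Rightarrow> real^'d::finite" and A :: "real^'d^'d"
  assumes p: "\<And>x. p x \<ge> 0" "p x \<noteq> 0"
    and A: "A ** transpose A = (\<Sum>x\<in>UNIV. p x *\<^sub>R outer (Y x))"
  shows "\<exists>u. A *v u = Y x"
proof -
  have "subspace (range ((*v) A))"
    by (intro linear_subspace_image matrix_vector_mul_linear) simp
  hence sp: "span (range ((*v) A)) = range ((*v) A)" by simp
  obtain y z where yz: "y \<in> range ((*v) A)" "\<And>w. w \<in> range ((*v) A) \<Longrightarrow> orthogonal z w" "Y x = y + z"
    using orthogonal_subspace_decomp_exists[of "range ((*v) A)" "Y x"] unfolding sp by blast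
  have "(z v* A) \<bullet> w = 0" for w
    using yz(2)[of "A *v w"] by (simp add: dot_lmul_matrix orthogonal_def)
  hence "z v* A = 0" by (metis inner_eq_zero_iff)
  hence "(\<Sum>x\<in>UNIV. p x * (z \<bullet> Y x)\<^sup>2) = 0"
    using covariance_quadratic_form[OF A, of z] by simp
  hence "p x * (z \<bullet> Y x)\<^sup>2 = 0"
    using p by (subst (asm) sum_nonneg_eq_0_iff) auto
  hence "z \<bullet> Y x = 0" using p(2) by simp
  moreover have "z \<bullet> y = 0" using yz(1,2) by (auto simp: orthogonal_def)
  ultimately have "z = 0" by (simp add: yz(3) inner_add_right)
  thus ?thesis using yz by auto
qed

lemma orthogonal_projection_exists:
  fixes R :: "'v::euclidean_space set"
  assumes "subspace R"
  shows "\<exists>P. (\<forall>u. P u \<in> R) \<and> (\<forall>u. \<forall>w\<in>R. (u - P u) \<bullet> w = 0)"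
proof -
  have sp: "span R = R" using assms by simp
  have "\<exists>y\<in>R. \<forall>w\<in>R. (u - y) \<bullet> w = 0" for u
  proof -
    obtain y z where "y \<in> R" "\<And>w. w \<in> R \<Longrightarrow> orthogonal z w" "u = y + z"
      using orthogonal_subspace_decomp_exists[of R u] unfolding sp by blast
    thus ?thesis by (intro bexI[of _ y]) (auto simp: orthogonal_def)
  qed
  thus ?thesis by metis
qed

lemma sum_UNIV_prod:
  "(\<Sum>z\<in>(UNIV :: ('a::finite \<times> 'c::finite) set). F z) = (\<Sum>x\<in>UNIV. \<Sum>y\<in>UNIV. F (x, y))"
  by (simp add: sum.cartesian_product flip: UNIV_Times_UNIV)

text \<open>If \<open>A\<close> is singular, the preimages of the steps under \<open>A\<close> only span its row space. Adding
  random signs times a rescaled basis of the orthogonal complement makes their covariance the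
  identity without changing their images under \<open>A\<close>.\<close>

lemma isotropic_lift:
  fixes Y :: "'a::finite \<Rightarrow> real^'d::finite" and A :: "real^'d^'d"
  assumes p: "\<And>x. p x \<ge> 0" "(\<Sum>x\<in>UNIV. p x) = 1" and mean: "(\<Sum>x\<in>UNIV. p x *\<^sub>R Y x) = 0"
    and A: "A ** transpose A = (\<Sum>x\<in>UNIV. p x *\<^sub>R outer (Y x))"
  obtains \<xi> :: "'a \<times> 'd \<times> bool \<Rightarrow> real^'d" where
    "isotropic_walk (\<lambda>(x, i, b). p x / (2 * real CARD('d))) \<xi>"
    "\<And>x i b. p x \<noteq> 0 \<Longrightarrow> A *v \<xi> (x, i, b) = Y x"
proof -
  define R where "R = range (\<lambda>c. c v* A)"
  have "subspace R"
    unfolding R_def using linear_subspace_image[OF matrix_vector_mul_linear[of "transpose A"], of UNIV] by simp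
  then obtain P where P: "\<And>u. P u \<in> R" "\<And>u w. w \<in> R \<Longrightarrow> (u - P u) \<bullet> w = 0"
    using orthogonal_projection_exists by metis
  have P_sym: "c \<bullet> P u = P c \<bullet> u" for c u
    using P(2)[OF P(1)[of u], of c] P(2)[OF P(1)[of c], of u]
    by (simp add: inner_diff_left inner_diff_right inner_commute)
  have AP: "A *v P u = A *v u" for u
  proof -
    have "(A *v u - A *v P u) \<bullet> c = 0" for c
    proof -
      have "(u - P u) \<bullet> (c v* A) = 0" by (rule P(2)) (simp add: R_def)
      moreover have "(c v* A) \<bullet> (u - P u) = c \<bullet> (A *v (u - P u))" by (rule dot_lmul_matrix)
      ultimately show ?thesis by (simp add: inner_commute matrix_vector_mult_diff_distrib)
    qed
    thus ?thesis by (metis inner_eq_zero_iff right_minus_eq)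
  qed
  obtain u where u: "\<And>x. p x \<noteq> 0 \<Longrightarrow> A *v u x = Y x"
    using step_in_range[OF p(1) _ A] by metis
  define D where "D = real CARD('d)"
  have D: "D > 0" by (simp add: D_def)
  \<comment> \<open>The \<open>\<eta> i\<close> need not be independent, but the squares of c
    \<bullet> \<eta> i sum to (norm (c - P c))^2. The factor sqrt D in \<open>\<xi>\<close> offsets
    the uniform choice of \<open>i\<close>.\<close>
  define \<eta> where "\<eta> i = axis i 1 - P (axis i 1)" for i :: 'd
  define \<xi> where "\<xi> = (\<lambda>(x, i, b). P (u x) + ((if b then 1 else -1) * sqrt D) *\<^sub>R \<eta> i)"
  have "isotropic_walk (\<lambda>(x, i :: 'd, b :: bool). p x / (2 * D)) \<xi>"
    unfolding isotropic_walk_def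
  proof (intro conjI allI)
    have sums: "(\<Sum>y\<in>(UNIV :: ('a \<times> 'd \<times> bool) set). F y) = (\<Sum>x\<in>UNIV. \<Sum>i\<in>UNIV. F (x, i, True) + F (x, i, False))" for F :: "_ \<Rightarrow> real"
      by (simp add: sum_UNIV_prod UNIV_bool add.commute)
    show "0 \<le> (case y of (x, i, b) \<Rightarrow> p x / (2 * D))" for y :: "'a \<times> 'd \<times> bool"
      using p D by (auto split: prod.splits)
    show "(\<Sum>y\<in>(UNIV :: ('a \<times> 'd \<times> bool) set). case y of (x, i, b) \<Rightarrow> p x / (2 * D)) = 1"
      unfolding sums using p D by (simp add: D_def)
    fix c :: "real^'d"
    obtain c' where c': "P c = c' v* A" using P(1)[of c] by (auto simp: R_def)
    \<comment> \<open>\<open>u x\<close> is unspecified when p x = 0; carrying the factor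
      \<open>p x\<close> along makes the identity hold for all x.\<close>
    have pc: "p x * F (c \<bullet> P (u x)) = p x * F (c' \<bullet> Y x)" for x and F :: "real \<Rightarrow> real"
      by (cases "p x = 0") (simp_all add: P_sym c' dot_lmul_matrix u)
    have "(\<Sum>y\<in>UNIV. (case y of (x, i, b) \<Rightarrow> p x / (2 * D)) * (c \<bullet> \<xi> y)) =
        (\<Sum>x\<in>UNIV. \<Sum>i\<in>(UNIV :: 'd set). (p x * (c' \<bullet> Y x)) / D)"
      unfolding sums
    proof (intro sum.cong refl)
      fix x and i :: 'd
      show "(case (x, i, True) of (x, i, b) \<Rightarrow> p x / (2 * D)) * (c \<bullet> \<xi> (x, i, True)) +
         (case (x, i, False) of (x, i, b) \<Rightarrow> p x / (2 * D)) * (c \<bullet> \<xi> (x, i, False)) = p x * (c' \<bullet> Y x) / D"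
        using pc[of x "\<lambda>s. s"] D by (simp add: \<xi>_def inner_add_right inner_diff_right field_simps)
    qed
    also have "\<dots> = c' \<bullet> (\<Sum>x\<in>UNIV. p x *\<^sub>R Y x)"
      using D by (simp add: D_def inner_sum_right)
    finally show "(\<Sum>y\<in>UNIV. (case y of (x, i, b) \<Rightarrow> p x / (2 * D)) * (c \<bullet> \<xi> y)) = 0"
      by (simp add: mean)
    have "(\<Sum>y\<in>UNIV. (case y of (x, i, b) \<Rightarrow> p x / (2 * D)) * (c \<bullet> \<xi> y)\<^sup>2) =
        (\<Sum>x\<in>UNIV. \<Sum>i\<in>(UNIV :: 'd set). (p x * (c' \<bullet> Y x)\<^sup>2) / D + p x * (c \<bullet> \<eta> i)\<^sup>2)"
      unfolding sums
    proof (intro sum.cong refl)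
      fix x and i :: 'd
      define s t where "s = c \<bullet> P (u x)" and "t = c \<bullet> \<eta> i"
      have "p x / (2 * D) * (s + sqrt D * t)\<^sup>2 + p x / (2 * D) * (s - sqrt D * t)\<^sup>2 = (p x * s\<^sup>2) / D + p x * t\<^sup>2"
        using D by (simp add: power2_sum power2_diff power_mult_distrib field_simps)
      thus "(case (x, i, True) of (x, i, b) \<Rightarrow> p x / (2 * D)) * (c \<bullet> \<xi> (x, i, True))\<^sup>2 +
         (case (x, i, False) of (x, i, b) \<Rightarrow> p x / (2 * D)) * (c \<bullet> \<xi> (x, i, False))\<^sup>2 =
         (p x * (c' \<bullet> Y x)\<^sup>2) / D + p x * (c \<bullet> \<eta> i)\<^sup>2"
        using pc[of x "\<lambda>s. s\<^sup>2"] by (simp add: \<xi>_def inner_add_right inner_diff_right s_def t_def)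
    qed
    also have "\<dots> = (\<Sum>x\<in>UNIV. p x * (c' \<bullet> Y x)\<^sup>2) + (\<Sum>x\<in>UNIV. p x) * (\<Sum>i\<in>UNIV. (c \<bullet> \<eta> i)\<^sup>2)"
      using D by (simp add: sum.distrib D_def sum_product)
    also have "(\<Sum>x\<in>UNIV. p x * (c' \<bullet> Y x)\<^sup>2) = (norm (P c))\<^sup>2"
      by (simp add: c' covariance_quadratic_form[OF A])
    also have "(\<Sum>i\<in>UNIV. (c \<bullet> \<eta> i)\<^sup>2) = (norm (c - P c))\<^sup>2"
      by (simp add: \<eta>_def inner_diff_right P_sym power2_norm_vec inner_axis)
    also have "(norm (P c))\<^sup>2 + (\<Sum>x\<in>UNIV. p x) * (norm (c - P c))\<^sup>2 = (norm c)\<^sup>2"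
      using P(2)[OF P(1)[of c], of c]
      by (simp add: p power2_norm_eq_inner inner_diff_left inner_diff_right inner_commute)
    finally show "(\<Sum>y\<in>UNIV. (case y of (x, i, b) \<Rightarrow> p x / (2 * D)) * (c \<bullet> \<xi> y)\<^sup>2) = (norm c)\<^sup>2" .
  qed
  moreover have "A *v \<xi> (x, i, b) = Y x" if "p x \<noteq> 0" for x i b
    by (simp add: \<xi>_def \<eta>_def AP u that matrix_vector_right_distrib matrix_vector_mult_diff_distrib
        matrix_vector_mult_scaleR)
  ultimately show ?thesis using that unfolding D_def by blast
qed

text \<open>Discards the auxiliary signs and indices of the lift.\<close>

lemma walk_marginal:
  fixes q :: "'a::finite \<times> 'c::finite \<Rightarrow> real"
  assumes "\<And>x. p x = (\<Sum>y\<in>UNIV. q (x, y))" "\<And>x y. q (x, y) \<noteq> 0 \<Longrightarrow> \<xi> (x, y) = Y x"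
  shows "walk q \<xi> n h = walk p Y n h"
proof (induction n arbitrary: h)
  case (Suc n)
  have "(\<Sum>z\<in>UNIV. q z * h (u + \<xi> z)) = (\<Sum>x\<in>UNIV. p x * h (u + Y x))" for u
  proof -
    have "(\<Sum>z\<in>UNIV. q z * h (u + \<xi> z)) = (\<Sum>x\<in>UNIV. \<Sum>y\<in>UNIV. q (x, y) * h (u + \<xi> (x, y)))"
      by (rule sum_UNIV_prod)
    also have "\<dots> = (\<Sum>x\<in>UNIV. \<Sum>y\<in>UNIV. q (x, y) * h (u + Y x))"
      using assms(2) by (intro sum.cong refl) (metis mult_eq_0_iff)
    finally show ?thesis by (simp add: assms(1) sum_distrib_right)
  qed
  thus ?case by (simp add: walk_Suc Suc.IH)
qed auto

text \<open>The image of the lifted walk under \<open>A\<close> has the law of the walk with steps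
  \<open>Y\<close>, so the isotropic bound carries over to every covariance.\<close>

theorem berry_esseen_upper_orthant:
  fixes Y :: "'a::finite \<Rightarrow> real^'d::finite" and A :: "real^'d^'d"
  assumes p: "\<And>x. p x \<ge> 0" "(\<Sum>x\<in>UNIV. p x) = 1" and mean: "(\<Sum>x\<in>UNIV. p x *\<^sub>R Y x) = 0"
    and A: "A ** transpose A = (\<Sum>x\<in>UNIV. p x *\<^sub>R outer (Y x))"
  shows "\<exists>C. \<forall>n>0. \<forall>z. \<bar>walk p Y n (\<lambda>u. of_bool (sqrt (real n) *\<^sub>R z \<le> u))
      - (\<integral>w. of_bool (z \<le> A *v w) \<partial>gauss_measure)\<bar> \<le> C * (1 + ln (real n)) / sqrt (real n)"
proof -
  obtain \<xi> :: "'a \<times> 'd \<times> bool \<Rightarrow> real^'d" where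
    iso: "isotropic_walk (\<lambda>(x, i, b). p x / (2 * real CARD('d))) \<xi>" and
    \<xi>: "\<And>x i b. p x \<noteq> 0 \<Longrightarrow> A *v \<xi> (x, i, b) = Y x"
    using isotropic_lift[OF p mean A] by blast
  let ?q = "\<lambda>(x, i :: 'd, b :: bool). p x / (2 * real CARD('d))"
  have "walk ?q \<xi> n (\<lambda>u. h (A *v u)) = walk p Y n h" for n h
  proof -
    have "walk ?q \<xi> n (\<lambda>u. h (A *v u)) = walk ?q (\<lambda>x. A *v \<xi> x) n h"
      by (rule walk_linear_image) (rule matrix_vector_mul_linear)
    also have "\<dots> = walk p Y n h"
    proof (rule walk_marginal)
      show "p x = (\<Sum>y\<in>UNIV. ?q (x, y))" for x
        by (simp add: case_prod_unfold)
      show "A *v \<xi> (x, y) = Y x" if "?q (x, y) \<noteq> 0" for x y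
        using that \<xi> by (cases y) auto
    qed
    finally show ?thesis .
  qed
  hence eq: "walk p Y n (\<lambda>u. of_bool (sqrt (real n) *\<^sub>R z \<le> u)) =
      walk ?q \<xi> n (\<lambda>u. of_bool (sqrt (real n) *\<^sub>R z \<le> A *v u))" for n z
    by (rule sym)
  show ?thesis unfolding eq by (rule berry_esseen_orthant[OF iso])
qed

section \<open>Concentration of types and Taylor expansion\<close>

lemma exp_le_quadratic:
  fixes x :: real
  assumes "\<bar>x\<bar> \<le> 1"
  shows "exp x \<le> 1 + x + x\<^sup>2"
proof (cases "x \<ge> 0")
  case True
  thus ?thesis using assms exp_bound[of x] by simp
next
  case False
  hence "\<bar>exp x - 1 - x\<bar> \<le> x\<^sup>2 / 2"
    using exp_remainder_2[of x] by (simp add: max_def)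
  thus ?thesis using zero_le_power2[of x] by linarith
qed

lemma walk_exp:
  fixes \<eta> :: "'b::finite \<Rightarrow> real"
  shows "walk q \<eta> n exp = (\<Sum>x\<in>UNIV. q x * exp (\<eta> x)) ^ n"
proof (induction n)
  case (Suc n)
  have "(\<Sum>x\<in>UNIV. q x * exp (u + \<eta> x)) = (\<Sum>x\<in>UNIV. q x * exp (\<eta> x)) * exp u" for u
    unfolding sum_distrib_right by (intro sum.cong refl) (simp add: exp_add)
  thus ?case by (simp add: walk_Suc walk_cmult Suc.IH)
qed auto

text \<open>A net of mesh 1 / 10 from compactness: moving a unit vector by less than 1 / 10 costs
  less than 1 / 10 in the inner product. The ratio 9 / 10 is sufficient later because its square
  exceeds ln 2.\<close>

lemma sphere_net:
  shows "\<exists>N :: ('v::euclidean_space) set. finite N \<and> (\<forall>u\<in>N. norm u = 1) \<and> (\<forall>v. v \<noteq> 0 \<longrightarrow> (\<exists>u\<in>N. 9 / 10 * norm v \<le> u \<bullet> v))"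
proof -
  obtain N :: "'v set" where N: "finite N" "N \<subseteq> sphere 0 1" "sphere 0 1 \<subseteq> (\<Union>x\<in>N. ball x (1 / 10))"
    using compact_sphere[of "0::'v" 1] 
      seq_compact_imp_totally_bounded[of "sphere (0::'v) 1"] unfolding compact_eq_seq_compact_metric
    by (meson divide_pos_pos zero_less_numeral zero_less_one)
  have "\<exists>u\<in>N. 9 / 10 * norm v \<le> u \<bullet> v" if v: "v \<noteq> 0" for v
  proof -
    define w where "w = v /\<^sub>R norm v"
    have w: "norm w = 1" "norm v *\<^sub>R w = v" using v by (simp_all add: w_def)
    have "w \<in> (\<Union>x\<in>N. ball x (1 / 10))"
      by (rule subsetD[OF N(3)]) (simp add: w(1))
    then obtain u where u: "u \<in> N" "dist u w < 1 / 10" by (auto simp only: UN_iff mem_ball)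
    have "\<bar>(u - w) \<bullet> w\<bar> \<le> norm (u - w) * norm w" by (rule Cauchy_Schwarz_ineq2)
    hence "9 / 10 \<le> u \<bullet> w"
      using u(2) w(1) by (simp add: dist_norm inner_diff_left flip: power2_norm_eq_inner)
    hence "norm v * (9 / 10) \<le> norm v * (u \<bullet> w)" by (intro mult_left_mono) auto
    also have "\<dots> = u \<bullet> v" unfolding inner_scaleR_right[symmetric] w(2) ..
    finally show ?thesis using u(1) by (auto simp: mult.commute)
  qed
  thus ?thesis using N by (intro exI[of _ N]) auto
qed

lemma prob_simplex_norm_le_1:
  assumes "p \<in> prob_simplex"
  shows "norm p \<le> 1"
proof -
  have "norm p \<le> (\<Sum>x\<in>UNIV. \<bar>p $ x\<bar>)" by (rule norm_le_l1_cart)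
  thus ?thesis using assms by (simp add: prob_simplex_def)
qed

lemma type_variance_le_1:
  fixes p u :: "real^'a::finite"
  assumes p: "p \<in> prob_simplex" and u: "norm u = 1"
  shows "(\<Sum>x\<in>UNIV. p $ x * (u \<bullet> (axis x 1 - p))) = 0"
    and "(\<Sum>x\<in>UNIV. p $ x * (u \<bullet> (axis x 1 - p))\<^sup>2) \<le> 1"
proof -
  have p1: "(\<Sum>x\<in>UNIV. p $ x) = 1" and p0: "\<And>x. p $ x \<ge> 0" using p by (auto simp: prob_simplex_def)
  define m where "m = u \<bullet> p"
  have m: "(\<Sum>x\<in>UNIV. p $ x * u $ x) = m" by (simp add: m_def inner_vec_def mult.commute)
  have e: "u \<bullet> (axis x 1 - p) = u $ x - m" for x by (simp add: inner_diff_right inner_axis m_def)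
  show "(\<Sum>x\<in>UNIV. p $ x * (u \<bullet> (axis x 1 - p))) = 0"
    by (simp add: e right_diff_distrib sum_subtractf m p1 flip: sum_distrib_right)
  have "(\<Sum>x\<in>UNIV. p $ x * (u $ x - m)\<^sup>2) = (\<Sum>x\<in>UNIV. p $ x * (u $ x)\<^sup>2) - 2 * m * (\<Sum>x\<in>UNIV. p $ x * u $ x) + m\<^sup>2 * (\<Sum>x\<in>UNIV. p $ x)"
    unfolding sum_distrib_left sum_subtractf[symmetric] sum.distrib[symmetric]
    by (intro sum.cong refl) (simp add: power2_diff algebra_simps)
  also have "\<dots> \<le> (\<Sum>x\<in>UNIV. p $ x * (u $ x)\<^sup>2)"
    by (simp add: m p1 power2_eq_square)
  also have "\<dots> \<le> (\<Sum>x\<in>UNIV. p $ x * 1)"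
  proof (intro sum_mono mult_left_mono p0)
    fix x
    show "(u $ x)\<^sup>2 \<le> 1" using component_le_norm_cart[of u x] u by (simp add: abs_square_le_1)
  qed
  finally show "(\<Sum>x\<in>UNIV. p $ x * (u \<bullet> (axis x 1 - p))\<^sup>2) \<le> 1" by (simp add: e p1)
qed

text \<open>A Chernoff bound in each direction of the net, then a union bound. The condition on
  \<open>n\<close> means T \<le> 1, which keeps the exponents in [-1, 1], where exp x \<le> 1 + x +
  x^2.\<close>

lemma type_concentration:
  fixes p :: "real^'a::finite"
  assumes p: "p \<in> prob_simplex"
  shows "\<exists>K\<ge>0. \<forall>n>0. 2 * log 2 (real n) / real n \<le> 1 \<longrightarrow>
    walk (($) p) (\<lambda>x. axis x 1 - p) n (\<lambda>S. of_bool ((norm S)\<^sup>2 > 2 * real n * log 2 (real n))) \<le> K / sqrt (real n)"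
proof -
  let ?X = "\<lambda>x. axis x 1 - p"
  have p1: "(\<Sum>x\<in>UNIV. p $ x) = 1" and p0: "\<And>x. p $ x \<ge> 0" using p by (auto simp: prob_simplex_def)
  obtain N :: "(real^'a) set" where N: "finite N" "\<And>u. u \<in> N \<Longrightarrow> norm u = 1"
    "\<And>v. v \<noteq> 0 \<Longrightarrow> \<exists>u\<in>N. 9 / 10 * norm v \<le> u \<bullet> v"
    using sphere_net by blast
  have "walk (($) p) ?X n (\<lambda>S. of_bool ((norm S)\<^sup>2 > 2 * real n * log 2 (real n))) \<le> real (card N) / sqrt (real n)"
    if n: "n > 0" "2 * log 2 (real n) / real n \<le> 1" for n
  proof -
    define T where "T = sqrt (2 * log 2 (real n) / real n)"
    have log: "log 2 (real n) \<ge> 0" using n by simp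
    have T2: "T\<^sup>2 = 2 * log 2 (real n) / real n" using log by (simp add: T_def)
    have T: "0 \<le> T" "T \<le> 1" using n log by (auto simp: T_def)
    \<comment> \<open>The minimiser of n l^2 - (9 / 10) n T l. The minimum is -(81 / 200) log 2 n,
      and it is at most -(ln n) / 2 since ln 2 \<le> 81 / 100.\<close>
    define l where "l = 9 / 20 * T"
    have nT: "2 * real n * log 2 (real n) = (real n * T)\<^sup>2"
      using n by (simp add: power_mult_distrib T2) (simp add: power2_eq_square)
    have expo: "exp (- l * (9 / 10 * (real n * T))) * exp (l\<^sup>2) ^ n \<le> 1 / sqrt (real n)"
    proof -
      have "exp (- l * (9 / 10 * (real n * T))) * exp (l\<^sup>2) ^ n = exp (real n * l\<^sup>2 - l * (9 / 10 * (real n * T)))"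
        by (simp add: exp_of_nat_mult[symmetric] exp_add[symmetric] algebra_simps)
      also have "real n * l\<^sup>2 - l * (9 / 10 * (real n * T)) = - (81 / 400 * real n * T\<^sup>2)"
        by (simp add: l_def power2_eq_square algebra_simps)
      also have "\<dots> = - (81 / 200) * log 2 (real n)"
        using n by (simp add: T2)
      also have "\<dots> \<le> - (ln (real n) / 2)"
      proof -
        have "ln (2::real) \<le> 81 / 100" using ln2_le_25_over_36 by simp
        hence "ln (real n) * ln 2 \<le> ln (real n) * (81 / 100)" using n by (intro mult_left_mono) auto
        thus ?thesis by (simp add: log_def field_simps)
      qed
      also have "exp (- (ln (real n) / 2)) = 1 / sqrt (real n)"
        using n by (simp add: exp_minus inverse_eq_divide ln_sqrt[symmetric])
      finally show ?thesis by simp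
    qed
    have "walk (($) p) ?X n (\<lambda>S. of_bool ((norm S)\<^sup>2 > 2 * real n * log 2 (real n))) \<le>
      walk (($) p) ?X n (\<lambda>S. \<Sum>u\<in>N. exp (- l * (9 / 10 * (real n * T))) * exp (l * (u \<bullet> S)))"
    proof (intro walk_mono p0)
      fix S :: "real^'a"
      show "of_bool ((norm S)\<^sup>2 > 2 * real n * log 2 (real n)) \<le>
         (\<Sum>u\<in>N. exp (- l * (9 / 10 * (real n * T))) * exp (l * (u \<bullet> S)))"
      proof (cases "(norm S)\<^sup>2 > 2 * real n * log 2 (real n)")
        case True
        hence nS: "norm S > real n * T" unfolding nT by (rule power_less_imp_less_base) simp
        moreover have "0 \<le> real n * T" using T by simp
        ultimately have "S \<noteq> 0" by auto
        then obtain u where u: "u \<in> N" "9 / 10 * norm S \<le> u \<bullet> S" using N(3) by blast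
        have "l * (9 / 10 * (real n * T)) \<le> l * (u \<bullet> S)"
          using u nS T by (intro mult_left_mono) (auto simp: l_def)
        hence "1 \<le> exp (- l * (9 / 10 * (real n * T))) * exp (l * (u \<bullet> S))"
          by (simp flip: exp_add)
        also have "\<dots> \<le> (\<Sum>u\<in>N. exp (- l * (9 / 10 * (real n * T))) * exp (l * (u \<bullet> S)))"
          by (rule member_le_sum[OF u(1)]) (use N in auto)
        finally show ?thesis by simp
      qed (auto intro!: sum_nonneg)
    qed
    also have "\<dots> = (\<Sum>u\<in>N. exp (- l * (9 / 10 * (real n * T))) * walk (($) p) ?X n (\<lambda>S. exp (l * (u \<bullet> S))))"
      unfolding walk_sum walk_cmult ..
    also have "\<dots> \<le> (\<Sum>u\<in>N. 1 / sqrt (real n))"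
    proof (intro sum_mono)
      fix u assume u: "u \<in> N"
      have "linear (\<lambda>S. l * (u \<bullet> S))"
        by (intro bounded_linear.linear bounded_linear_intros)
      hence "walk (($) p) ?X n (\<lambda>S. exp (l * (u \<bullet> S))) = walk (($) p) (\<lambda>x. l * (u \<bullet> ?X x)) n exp"
        by (rule walk_linear_image)
      also have "\<dots> = (\<Sum>x\<in>UNIV. p $ x * exp (l * (u \<bullet> ?X x))) ^ n"
        by (rule walk_exp)
      also have "\<dots> \<le> exp (l\<^sup>2) ^ n"
      proof (intro power_mono)
        have "(\<Sum>x\<in>UNIV. p $ x * exp (l * (u \<bullet> ?X x))) \<le> (\<Sum>x\<in>UNIV. p $ x * (1 + l * (u \<bullet> ?X x) + (l * (u \<bullet> ?X x))\<^sup>2))"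
        proof (intro sum_mono mult_left_mono exp_le_quadratic p0)
          fix x
          have "\<bar>u \<bullet> ?X x\<bar> \<le> norm u * norm (?X x)" by (rule Cauchy_Schwarz_ineq2)
          also have "\<dots> \<le> 2"
            using norm_triangle_ineq4[of "axis x 1" p] prob_simplex_norm_le_1[OF p] N(2)[OF u] by simp
          finally have "l * \<bar>u \<bullet> ?X x\<bar> \<le> 1 / 2 * 2" using T by (intro mult_mono) (auto simp: l_def)
          thus "\<bar>l * (u \<bullet> ?X x)\<bar> \<le> 1" using T by (simp add: abs_mult l_def)
        qed
        also have "\<dots> = (\<Sum>x\<in>UNIV. p $ x) + l * (\<Sum>x\<in>UNIV. p $ x * (u \<bullet> ?X x)) + l\<^sup>2 * (\<Sum>x\<in>UNIV. p $ x * (u \<bullet> ?X x)\<^sup>2)"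
        proof -
          have "p $ x * (1 + l * a + (l * a)\<^sup>2) = p $ x + l * (p $ x * a) + l\<^sup>2 * (p $ x * a\<^sup>2)" for x a
            by (simp add: power_mult_distrib algebra_simps)
          thus ?thesis by (simp only: sum.distrib sum_distrib_left)
        qed
        also have "\<dots> \<le> 1 + l\<^sup>2 * 1"
          unfolding type_variance_le_1(1)[OF p N(2)[OF u]] p1
          using mult_left_mono[OF type_variance_le_1(2)[OF p N(2)[OF u]], of "l\<^sup>2"] by simp
        also have "\<dots> \<le> exp (l\<^sup>2)" by simp
        finally show "(\<Sum>x\<in>UNIV. p $ x * exp (l * (u \<bullet> ?X x))) \<le> exp (l\<^sup>2)" .
      qed (auto intro!: sum_nonneg mult_nonneg_nonneg p0)
      finally show "exp (- l * (9 / 10 * (real n * T))) * walk (($) p) ?X n (\<lambda>S. exp (l * (u \<bullet> S))) \<le> 1 / sqrt (real n)"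
        using expo by (meson mult_left_mono exp_ge_zero order_trans)
    qed
    finally show ?thesis by simp
  qed
  thus ?thesis by (intro exI[of _ "real (card N)"]) auto
qed

section \<open>Second-order Taylor bound\<close>

lemma norm_matrix_vector_mult_le:
  fixes M :: "real^'n::finite^'m::finite"
  shows "norm (M *v h) \<le> norm M * norm h"
proof -
  \<comment> \<open>\<open>norm M\<close> is the Frobenius norm here; Cauchy-Schwarz is applied row
    by row.\<close>
  have "(norm (M *v h))\<^sup>2 = (\<Sum>i\<in>UNIV. (M $ i \<bullet> h)\<^sup>2)"
    by (simp add: power2_norm_vec matrix_vector_mul_component)
  also have "\<dots> \<le> (\<Sum>i\<in>UNIV. (norm (M $ i))\<^sup>2 * (norm h)\<^sup>2)"
  proof (intro sum_mono)
    fix i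
    show "(M $ i \<bullet> h)\<^sup>2 \<le> (norm (M $ i))\<^sup>2 * (norm h)\<^sup>2"
      unfolding power_mult_distrib[symmetric] using Cauchy_Schwarz_ineq2[of "M $ i" h]
      by (metis abs_ge_zero power2_abs power_mono)
  qed
  also have "\<dots> = (norm M * norm h)\<^sup>2"
    by (simp add: norm_vec_def[of M] L2_set_def power_mult_distrib sum_nonneg sum_distrib_right)
  finally show ?thesis by (rule power2_le_imp_le) simp
qed

text \<open>Lagrange remainder along the segment from p to p + h. By continuity the Hessian at the
  intermediate point is within 1 of \<open>H p\<close>; this is the origin of the + 1.\<close>

lemma second_order_taylor:
  fixes f :: "real^'a::finite \<Rightarrow> real" and D :: "real^'a \<Rightarrow> real^'a" and H :: "real^'a \<Rightarrow> real^'a^'a"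
  assumes U: "open U" "p \<in> U"
    and D: "\<And>q. q \<in> U \<Longrightarrow> (f has_derivative (\<lambda>h. D q \<bullet> h)) (at q)"
    and H: "\<And>q. q \<in> U \<Longrightarrow> (D has_derivative (\<lambda>h. H q *v h)) (at q)"
    and cont: "continuous_on U H"
  shows "\<exists>\<delta>>0. \<forall>h. norm h < \<delta> \<longrightarrow> \<bar>f (p + h) - f p - D p \<bullet> h\<bar> \<le> (onorm (\<lambda>h. H p *v h) + 1) / 2 * (norm h)\<^sup>2"
proof -
  obtain \<delta>1 where \<delta>1: "\<delta>1 > 0" "ball p \<delta>1 \<subseteq> U" using U open_contains_ball by blast
  have "isCont H p" using cont U by (simp add: continuous_on_eq_continuous_at)
  then obtain \<delta>2 where \<delta>2: "\<delta>2 > 0" "\<And>q. dist q p < \<delta>2 \<Longrightarrow> dist (H q) (H p) < 1"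
    unfolding continuous_at_eps_delta by (metis zero_less_one)
  have bl: "bounded_linear (\<lambda>h. H p *v h)" by (rule matrix_vector_mul_bounded_linear)
  have "\<bar>f (p + h) - f p - D p \<bullet> h\<bar> \<le> (onorm (\<lambda>h. H p *v h) + 1) / 2 * (norm h)\<^sup>2" if h: "norm h < min \<delta>1 \<delta>2" for h
  proof -
    have near: "dist (p + s *\<^sub>R h) p < min \<delta>1 \<delta>2" if "0 \<le> s" "s \<le> 1" for s
    proof -
      have "s * norm h \<le> norm h" using that by (simp add: mult_left_le_one_le)
      thus ?thesis using h that by (simp add: dist_norm)
    qed
    have inU: "p + s *\<^sub>R h \<in> U" if "0 \<le> s" "s \<le> 1" for s
      using near[OF that] \<delta>1(2) by (auto simp: dist_commute)
    define \<phi> where "\<phi> m s = (if m = 0 then f (p + s *\<^sub>R h) else if m = 1 then D (p + s *\<^sub>R h) \<bullet> h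
       else (H (p + s *\<^sub>R h) *v h) \<bullet> h)" for m :: nat and s :: real
    have line: "((\<lambda>s. p + s *\<^sub>R h) has_derivative (\<lambda>s. s *\<^sub>R h)) (at s)" for s :: real
      by (auto intro!: derivative_eq_intros)
    have d0: "DERIV (\<phi> 0) s :> \<phi> 1 s" if "0 \<le> s" "s \<le> 1" for s
      using has_derivative_compose[OF line D[OF inU[OF that]]]
      by (simp add: \<phi>_def[abs_def] has_field_derivative_def mult.commute[of _ "_ \<bullet> _"])
    have d1: "DERIV (\<phi> 1) s :> \<phi> 2 s" if "0 \<le> s" "s \<le> 1" for s
      using has_derivative_inner_left[OF has_derivative_compose[OF line H[OF inU[OF that]]], of h]
      by (simp add: \<phi>_def[abs_def] has_field_derivative_def matrix_vector_mult_scaleR mult.commute[of _ "_ \<bullet> _"])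
    have "\<exists>t>0. t < 1 \<and> \<phi> 0 1 = (\<Sum>m<2. \<phi> m 0 / fact m * 1 ^ m) + \<phi> 2 t / fact 2 * 1 ^ 2"
    proof (rule Maclaurin)
      show "\<forall>m t. m < 2 \<and> 0 \<le> t \<and> t \<le> 1 \<longrightarrow> DERIV (\<phi> m) t :> \<phi> (Suc m) t"
        using d0 d1 by (metis One_nat_def less_2_cases numeral_2_eq_2)
    qed auto
    then obtain t where t: "0 < t" "t < 1" "\<phi> 0 1 = (\<Sum>m<2. \<phi> m 0 / fact m * 1 ^ m) + \<phi> 2 t / fact 2 * 1 ^ 2"
      by blast
    define q where "q = p + t *\<^sub>R h"
    have "\<phi> 0 1 = \<phi> 0 0 + \<phi> 1 0 + \<phi> 2 t / 2"
      using t(3) by (simp add: eval_nat_numeral)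
    hence "f (p + h) - f p - D p \<bullet> h = ((H q *v h) \<bullet> h) / 2"
      by (simp add: \<phi>_def q_def)
    moreover have "\<bar>(H q *v h) \<bullet> h\<bar> \<le> norm (H q *v h) * norm h"
      by (rule Cauchy_Schwarz_ineq2)
    moreover have "norm (H q *v h) \<le> (onorm (\<lambda>h. H p *v h) + 1) * norm h"
    proof -
      have "H q *v h = H p *v h + (H q - H p) *v h" by (simp add: matrix_vector_mult_diff_rdistrib)
      hence "norm (H q *v h) \<le> norm (H p *v h) + norm ((H q - H p) *v h)"
        by (metis norm_triangle_ineq)
      also have "norm (H p *v h) \<le> onorm (\<lambda>h. H p *v h) * norm h" by (rule onorm[OF bl])
      also have "norm ((H q - H p) *v h) \<le> norm (H q - H p) * norm h" by (rule norm_matrix_vector_mult_le)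
      also have "\<dots> \<le> 1 * norm h"
        using \<delta>2(2)[of q] near[of t] t by (intro mult_right_mono) (auto simp: q_def dist_norm)
      finally show ?thesis by (simp add: distrib_right)
    qed
    hence "norm (H q *v h) * norm h \<le> (onorm (\<lambda>h. H p *v h) + 1) * norm h * norm h"
      by (rule mult_right_mono) simp
    moreover have "(onorm (\<lambda>h. H p *v h) + 1) / 2 * (norm h)\<^sup>2 = (onorm (\<lambda>h. H p *v h) + 1) * norm h * norm h / 2"
      by (simp add: power2_eq_square)
    ultimately show ?thesis by linarith
  qed
  thus ?thesis using \<delta>1 \<delta>2 by (intro exI[of _ "min \<delta>1 \<delta>2"]) auto
qed

section \<open>Types as walks and assembly of the estimates\<close>

lemma sum_list_map_axis_minus:
  "sum_list (map (\<lambda>x. axis x 1 - p) xs) = real (length xs) *\<^sub>R (type_of xs - p)"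
proof -
  have "(sum_list (map (\<lambda>x. axis x 1 - p) xs)) $ a = real (count_list xs a) - real (length xs) * p $ a" for a
    by (induction xs) (auto simp: axis_def algebra_simps)
  thus ?thesis by (cases "xs = []") (auto simp: vec_eq_iff type_of_def algebra_simps)
qed

text \<open>With steps \<open>axis x 1 - p\<close> the walk ends at n times the deviation of the
  type from \<open>p\<close>, so p + S / n is the type itself.\<close>

lemma iid_prob_eq_walk:
  assumes "n > 0" "\<And>xs. length xs = n \<Longrightarrow> E xs = F (type_of xs)"
  shows "iid_prob p n E = walk (($) p) (\<lambda>x. axis x 1 - p) n (\<lambda>S. of_bool (F (p + S /\<^sub>R real n)))"
proof -
  have "iid_prob p n E = (\<Sum>xs | length xs = n. if E xs then \<Prod>i<n. p $ (xs ! i) else 0)"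
    unfolding iid_prob_def by (subst sum.inter_filter[symmetric]) (auto simp: finite_length_eq)
  also have "\<dots> = walk (($) p) (\<lambda>x. axis x 1 - p) n (\<lambda>S. of_bool (F (p + S /\<^sub>R real n)))"
    unfolding walk_def
  proof (intro sum.cong refl)
    fix xs :: "'a list" assume xs: "xs \<in> {xs. length xs = n}"
    have "prod_list (map (($) p) xs) = (\<Prod>i<n. p $ (xs ! i))"
      using xs by (simp add: prod.list_conv_set_nth atLeast0LessThan)
    moreover have "p + sum_list (map (\<lambda>x. axis x 1 - p) xs) /\<^sub>R real n = type_of xs"
      using xs assms(1) by (simp add: sum_list_map_axis_minus)
    ultimately show "(if E xs then \<Prod>i<n. p $ (xs ! i) else 0) = prod_list (map (($) p) xs) *
        of_bool (F (p + sum_list (map (\<lambda>x. axis x 1 - p) xs) /\<^sub>R real n))"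
      using assms(2)[of xs] xs by simp
  qed
  finally show ?thesis .
qed

text \<open>Derivatives are taken on an open set around the simplex because the simplex has empty
  interior in \<open>real^'a\<close>. The O-term becomes one constant \<open>C\<close> for all n
  \<ge> 2; at n = 1 the logarithm would vanish.\<close>

theorem theorem6:
  fixes p :: "real^'a::finite"
    and g :: "real^'a \<Rightarrow> real^'d::finite"
    and U :: "(real^'a) set"
    and Dg :: "'d \<Rightarrow> real^'a \<Rightarrow> real^'a"
    and Hg :: "'d \<Rightarrow> real^'a \<Rightarrow> real^'a^'a"
    and z :: "real^'d"
  assumes p_simplex: "p \<in> prob_simplex"
    and U_open: "open U" and U_simplex: "prob_simplex \<subseteq> U"
    and grad: "\<And>t q. q \<in> U \<Longrightarrow> ((\<lambda>q. g q $ t) has_derivative (\<lambda>h. Dg t q \<bullet> h)) (at q)"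
    and hess: "\<And>t q. q \<in> U \<Longrightarrow> (Dg t has_derivative (\<lambda>h. Hg t q *v h)) (at q)"
    and hess_cont: "\<And>t. continuous_on U (Hg t)"
    and rank_V: "rank (\<Sum>x\<in>UNIV. p $ x *\<^sub>R outer ((\<chi> t. Dg t p $ x)
                    - (\<Sum>y\<in>UNIV. p $ y *\<^sub>R (\<chi> t. Dg t p $ y)))) \<ge> 1"
  shows "\<exists>C. \<forall>n\<ge>2.
    iid_prob p n (\<lambda>xs. g (type_of xs) \<ge>
        g p + (1 / sqrt (real n)) *\<^sub>R z
          - (((MAX t. onorm (\<lambda>h. Hg t p *v h)) + 1) * log 2 (real n) / real n) *\<^sub>R (\<chi> t. 1))
    \<ge> gauss_upper_prob (\<Sum>x\<in>UNIV. p $ x *\<^sub>R outer ((\<chi> t. Dg t p $ x)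
                    - (\<Sum>y\<in>UNIV. p $ y *\<^sub>R (\<chi> t. Dg t p $ y)))) z
      - C * log 2 (real n) / sqrt (real n)"
proof -
  define Y where "Y x = (\<chi> t. Dg t p $ x) - (\<Sum>y\<in>UNIV. p $ y *\<^sub>R (\<chi> t. Dg t p $ y))" for x
  define V where "V = (\<Sum>x\<in>UNIV. p $ x *\<^sub>R outer (Y x))"
  define \<kappa> where "\<kappa> = (MAX t. onorm (\<lambda>h. Hg t p *v h))"
  define X where "X x = axis x 1 - p" for x
  define L where "L h = (\<chi> t. Dg t p \<bullet> h)" for h
  have p0: "\<And>x. p $ x \<ge> 0" and p1: "(\<Sum>x\<in>UNIV. p $ x) = 1"
    using p_simplex by (auto simp: prob_simplex_def)
  have pU: "p \<in> U" using p_simplex U_simplex by auto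

  define A where "A = (SOME A :: real^'d^'d. A ** transpose A = V)"
  have A: "A ** transpose A = (\<Sum>x\<in>UNIV. p $ x *\<^sub>R outer (Y x))"
    unfolding A_def V_def[symmetric]
    using covariance_factorization[of "($) p" Y] p0 by (intro someI_ex[of "\<lambda>A. A ** transpose A = V"]) (auto simp: V_def)
  define \<Gamma> where "\<Gamma> = gauss_upper_prob V z"
  have \<Gamma>: "\<Gamma> = (\<integral>w. of_bool (z \<le> A *v w) \<partial>gauss_measure)"
    unfolding \<Gamma>_def gauss_upper_prob_def A_def[symmetric] by (rule measure_std_gauss_orthant)
  have "\<Gamma> \<le> (\<integral>w. 1 \<partial>(gauss_measure :: (real^'d) measure))"
  proof -
    have "integrable gauss_measure (\<lambda>w. 1 * of_bool (z \<le> A *v w) :: real)"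
      by (rule integrable_mult_bounded) auto
    thus ?thesis unfolding \<Gamma> by (intro integral_mono) auto
  qed
  hence \<Gamma>1: "\<Gamma> \<le> 1" by simp

  \<comment> \<open>The linear part of \<open>g\<close> turns the centred steps of the type into the
    centred gradient vectors, whose covariance is \<open>V\<close>.\<close>
  have LX: "L (X x) = Y x" for x
  proof -
    have "Dg t p \<bullet> p = (\<Sum>y\<in>UNIV. p $ y * Dg t p $ y)" for t
      by (simp add: inner_vec_def mult.commute)
    thus ?thesis by (simp add: vec_eq_iff L_def X_def Y_def inner_diff_right inner_axis)
  qed
  have linL: "linear L"
    by (rule linearI) (simp_all add: L_def vec_eq_iff inner_add_right)
  have meanY: "(\<Sum>x\<in>UNIV. p $ x *\<^sub>R Y x) = 0"
    by (simp add: Y_def scaleR_right_diff_distrib sum_subtractf p1 flip: scaleR_left.sum)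
  obtain C1 where C1: "\<And>n. n > 0 \<Longrightarrow> \<bar>walk (($) p) Y n (\<lambda>u. of_bool (sqrt (real n) *\<^sub>R z \<le> u)) - \<Gamma>\<bar>
      \<le> C1 * (1 + ln (real n)) / sqrt (real n)"
    using berry_esseen_upper_orthant[OF p0 p1 meanY A] unfolding \<Gamma> by blast
  obtain K where K: "K \<ge> 0" "\<And>n. n > 0 \<Longrightarrow> 2 * log 2 (real n) / real n \<le> 1 \<Longrightarrow>
    walk (($) p) X n (\<lambda>S. of_bool ((norm S)\<^sup>2 > 2 * real n * log 2 (real n))) \<le> K / sqrt (real n)"
    using type_concentration[OF p_simplex] unfolding X_def[abs_def] by blast

  have "\<exists>\<delta>>0. \<forall>h. norm h < \<delta> \<longrightarrow> \<bar>g (p + h) $ t - g p $ t - Dg t p \<bullet> h\<bar> \<le> (onorm (\<lambda>h. Hg t p *v h) + 1) / 2 * (norm h)\<^sup>2" for t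
    by (rule second_order_taylor[OF U_open pU grad hess hess_cont])
  then obtain \<delta> where \<delta>: "\<And>t. \<delta> t > 0" "\<And>t h. norm h < \<delta> t \<Longrightarrow>
      \<bar>g (p + h) $ t - g p $ t - Dg t p \<bullet> h\<bar> \<le> (onorm (\<lambda>h. Hg t p *v h) + 1) / 2 * (norm h)\<^sup>2"
    by metis
  \<comment> \<open>A radius valid for all coordinates. The minimum with 1 also yields the condition
    on \<open>n\<close> in \<open>type_concentration\<close>.\<close>
  define \<delta>0 where "\<delta>0 = min 1 (Min (range \<delta>))"
  have \<delta>0: "\<delta>0 > 0" "\<delta>0 \<le> 1" "\<And>t. \<delta>0 \<le> \<delta> t"
    using \<delta>(1) by (auto simp: \<delta>0_def min_le_iff_disj)
  have \<kappa>: "onorm (\<lambda>h. Hg t p *v h) \<le> \<kappa>" for t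
    unfolding \<kappa>_def by (rule Max_ge) auto
  have taylor: "g p $ t + Dg t p \<bullet> h - (\<kappa> + 1) / 2 * (norm h)\<^sup>2 \<le> g (p + h) $ t" if "norm h < \<delta>0" for t h
  proof -
    have "(onorm (\<lambda>h. Hg t p *v h) + 1) / 2 * (norm h)\<^sup>2 \<le> (\<kappa> + 1) / 2 * (norm h)\<^sup>2"
      using \<kappa>[of t] by (intro mult_right_mono) auto
    thus ?thesis using \<delta>(2)[of h t] that \<delta>0(3)[of t] by linarith
  qed
  have \<kappa>0: "\<kappa> \<ge> 0"
    using \<kappa>[of undefined] onorm_pos_le[OF matrix_vector_mul_bounded_linear, of "Hg undefined p"] by linarith

  have "(\<lambda>n. 2 / ln 2 * (ln (real n) / real n)) \<longlonglongrightarrow> 2 / ln 2 * 0"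
    by (intro tendsto_intros lim_ln_over_n)
  hence "\<forall>\<^sub>F n in sequentially. 2 / ln 2 * (ln (real n) / real n) < \<delta>0\<^sup>2"
    using \<delta>0 by (intro order_tendstoD) auto
  then obtain n0 where n0: "\<And>n. n \<ge> n0 \<Longrightarrow> 2 * log 2 (real n) / real n < \<delta>0\<^sup>2"
    unfolding eventually_sequentially log_def by auto

  define G where "G n xs \<longleftrightarrow> g (type_of xs) \<ge> g p + (1 / sqrt (real n)) *\<^sub>R z
      - ((\<kappa> + 1) * log 2 (real n) / real n) *\<^sub>R (\<chi> t. 1)" for n xs
  \<comment> \<open>2 \<bar>C1\<bar> comes from 1 + ln n \<le> 2 log 2 n. The term sqrt n0 makes the
    error at least 1 when n < n0, where the claim is then trivial because \<Gamma> \<le> 1.\<close>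
  define C where "C = 2 * \<bar>C1\<bar> + K + sqrt (real n0)"
  have "iid_prob p n (G n) \<ge> \<Gamma> - C * log 2 (real n) / sqrt (real n)" if n: "n \<ge> 2" for n
  proof -
    have log1: "log 2 (real n) \<ge> 1" using n by simp
    have sn: "sqrt (real n) > 0" using n by simp
    show ?thesis
    proof (cases "n \<ge> n0")
      case False
      have "sqrt (real n) * 1 \<le> sqrt (real n0) * log 2 (real n)"
        using False log1 by (intro mult_mono) auto
      also have "\<dots> \<le> C * log 2 (real n)"
        using log1 K by (intro mult_right_mono) (auto simp: C_def)
      finally have "1 \<le> C * log 2 (real n) / sqrt (real n)" using sn by simp
      moreover have "iid_prob p n (G n) \<ge> 0"
        unfolding iid_prob_def by (intro sum_nonneg prod_nonneg p0)
      ultimately show ?thesis using \<Gamma>1 by linarith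
    next
      case True
      note small = n0[OF True]
      have small1: "2 * log 2 (real n) / real n \<le> 1"
        using small \<delta>0 power_le_one[of \<delta>0 2] by linarith
      let ?F = "\<lambda>q. g q \<ge> g p + (1 / sqrt (real n)) *\<^sub>R z - ((\<kappa> + 1) * log 2 (real n) / real n) *\<^sub>R (\<chi> t. 1)"
      \<comment> \<open>A union bound for indicators. Off the tail event the squared norm of S / n
        is at most 2 log 2 n / n, and (\<kappa> + 1) / 2 times this is exactly b_n.\<close>
      have event: "of_bool (sqrt (real n) *\<^sub>R z \<le> L S) - of_bool ((norm S)\<^sup>2 > 2 * real n * log 2 (real n))
          \<le> (of_bool (?F (p + S /\<^sub>R real n)) :: real)" for S
      proof (cases "sqrt (real n) *\<^sub>R z \<le> L S \<and> (norm S)\<^sup>2 \<le> 2 * real n * log 2 (real n)")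
        case S: True
        define h where "h = S /\<^sub>R real n"
        have "(norm h)\<^sup>2 = (norm S)\<^sup>2 / (real n)\<^sup>2"
          by (simp add: h_def power_mult_distrib power_inverse field_simps)
        also have "\<dots> \<le> 2 * real n * log 2 (real n) / (real n)\<^sup>2"
          using S by (intro divide_right_mono) auto
        also have "\<dots> = 2 * log 2 (real n) / real n"
          using n by (simp add: power2_eq_square)
        finally have h2: "(norm h)\<^sup>2 \<le> 2 * log 2 (real n) / real n" .
        hence "norm h < \<delta>0"
          using small \<delta>0(1) by (intro power_less_imp_less_base[of "norm h" 2 \<delta>0]) auto
        note T = taylor[OF this]
        have "?F (p + h)"
          unfolding less_eq_vec_def
        proof
          fix t
          have "(\<kappa> + 1) / 2 * (norm h)\<^sup>2 \<le> (\<kappa> + 1) / 2 * (2 * log 2 (real n) / real n)"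
            using h2 \<kappa>0 by (intro mult_left_mono) auto
          hence 1: "(\<kappa> + 1) / 2 * (norm h)\<^sup>2 \<le> (\<kappa> + 1) * log 2 (real n) / real n" by simp
          have "sqrt (real n) * z $ t \<le> Dg t p \<bullet> S"
            using S by (auto simp: less_eq_vec_def L_def)
          hence "sqrt (real n) * z $ t / real n \<le> Dg t p \<bullet> S / real n"
            by (intro divide_right_mono) auto
          moreover have "sqrt (real n) * z $ t / real n = z $ t / sqrt (real n)"
            using n by (simp add: field_simps)
          moreover have "Dg t p \<bullet> S / real n = Dg t p \<bullet> h"
            by (simp add: h_def divide_inverse mult.commute)
          ultimately have 2: "z $ t / sqrt (real n) \<le> Dg t p \<bullet> h" by simp
          show "(g p + (1 / sqrt (real n)) *\<^sub>R z - ((\<kappa> + 1) * log 2 (real n) / real n) *\<^sub>R (\<chi> t. 1)) $ t \<le> g (p + h) $ t"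
            using T[of t] 1 2 by simp
        qed
        thus ?thesis by (simp add: h_def)
      qed auto
      have "walk (($) p) X n (\<lambda>S. of_bool (sqrt (real n) *\<^sub>R z \<le> L S)) =
          walk (($) p) Y n (\<lambda>u. of_bool (sqrt (real n) *\<^sub>R z \<le> u))"
        using walk_linear_image[OF linL, of "($) p" X n "\<lambda>u. of_bool (sqrt (real n) *\<^sub>R z \<le> u)"] by (simp add: LX)
      moreover have "iid_prob p n (G n) = walk (($) p) X n (\<lambda>S. of_bool (?F (p + S /\<^sub>R real n)))"
        unfolding X_def[abs_def] using n by (intro iid_prob_eq_walk) (auto simp: G_def)
      moreover have "walk (($) p) X n (\<lambda>S. of_bool (sqrt (real n) *\<^sub>R z \<le> L S) - of_bool ((norm S)\<^sup>2 > 2 * real n * log 2 (real n)))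
          \<le> walk (($) p) X n (\<lambda>S. of_bool (?F (p + S /\<^sub>R real n)))"
        by (intro walk_mono p0 event)
      moreover have "walk (($) p) X n (\<lambda>S. of_bool ((norm S)\<^sup>2 > 2 * real n * log 2 (real n))) \<le> K / sqrt (real n)"
        using K(2) n small1 by simp
      moreover have "\<Gamma> - walk (($) p) Y n (\<lambda>u. of_bool (sqrt (real n) *\<^sub>R z \<le> u)) \<le> C1 * (1 + ln (real n)) / sqrt (real n)"
        using C1[of n] n by linarith
      moreover have "C1 * (1 + ln (real n)) / sqrt (real n) + K / sqrt (real n) \<le> C * log 2 (real n) / sqrt (real n)"
      proof -
        have "ln (real n) * ln 2 \<le> ln (real n) * 1"
          using n ln_2_less_1 by (intro mult_left_mono) auto
        hence "ln (real n) \<le> log 2 (real n)" by (simp add: log_def field_simps)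
        hence "1 + ln (real n) \<le> 2 * log 2 (real n)" using log1 by linarith
        hence "C1 * (1 + ln (real n)) \<le> \<bar>C1\<bar> * (2 * log 2 (real n))"
          using n by (intro mult_mono) auto
        moreover have "K * 1 \<le> K * log 2 (real n)" using K log1 by (intro mult_left_mono) auto
        moreover have "0 \<le> sqrt (real n0) * log 2 (real n)" using log1 by simp
        ultimately have "C1 * (1 + ln (real n)) + K \<le> C * log 2 (real n)"
          unfolding C_def distrib_right by linarith
        thus ?thesis using sn by (simp add: divide_right_mono flip: add_divide_distrib)
      qed
      ultimately show ?thesis unfolding walk_diff by linarith
    qed
  qed
  thus ?thesis unfolding G_def \<kappa>_def \<Gamma>_def V_def Y_def by blast
qed

end
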